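(* Let $\mathbb{F}_\theta^+$ be an aperiodic single vertex $k$-graph with intrinsic group $G$ of rank $r$, and let $g_1,\ldots,g_r$ be generators (a basis) of $G$. Let $U_1,\ldots,U_r\in\mathcal{O}_\theta$ be the unitaries $$U_p=\sum_{u\in\Lambda^{(g_p)_+}} s_us_{\jmath_p(u)}^*\qquad(1\le p\le r),$$ where $\jmath_p$ is a fixed bijection from $\Lambda^{(g_p)_+}$ onto $\Lambda^{(g_p)_-}$ (if $r=0$, the convention is that the family of unitaries is replaced by $U_0=I$). Then $$\mathcal{O}_\theta^\sigma=\mathrm{C}^*(X\in\mathcal{O}_\theta: d(X)\in G)=\mathrm{C}^*(\mathfrak{F},U_1,\ldots,U_r).$$
   Context: A single vertex $k$-graph $\Lambda=\mathbb{F}_\theta^+$ is a monoid (a small category with one object) with a degree homomorphism $d:\Lambda\to\mathbb{N}^k$ satisfying the factorization property: whenever $d(\lambda)=p+q$ with $p,q\in\mathbb{N}^k$, there are unique $\mu,\nu\in\Lambda$ with $\lambda=\mu\nu$, $d(\mu)=p$, $d(\nu)=q$. Let $\epsilon_1,\ldots,\epsilon_k$ be the standard generators of $\mathbb{Z}^k$. The elements of degree $\epsilon_i$ are the edges $e^i_1,\ldots,e^i_{m_i}$, finitely many; for $i<j$ the relations $e^i_{s}e^j_{t}=e^j_{t'}e^i_{s'}$ define permutations $\theta_{ij}(s,t)=(s',t')$. For $p\in\mathbb{N}^k$, $\Lambda^p=\{w\in\Lambda:d(w)=p\}$. Put $m=(m_1,\ldots,m_k)$ and $m^p=\prod_i m_i^{p_i}$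 for $p\in\mathbb{Z}^k$. For $p\in\mathbb{Z}^k$, $p_+=p\vee 0$ and $p_-=(-p)\vee 0$ (coordinatewise maxima). The intrinsic group is $G=\{g\in\mathbb{Z}^k:m^g=1\}$; for $g\in G$, $m^{g_+}=m^{g_-}$, so $|\Lambda^{g_+}|=|\Lambda^{g_-}|$. A tuple $(V_1,\ldots,V_n)$ in a unital C*-algebra is of Cuntz-type if $V_i^*V_j=\delta_{i,j}I$ and $\sum_iV_iV_i^*=I$. A Cuntz-type representation of $\mathbb{F}_\theta^+$ consists of Cuntz-type tuples $E^i=(E^i_1,\ldots,E^i_{m_i})$ ($1\le i\le k$) satisfying $E^i_sE^j_t=E^j_{t'}E^i_{s'}$ whenever $i<j$ and $\theta_{ij}(s,t)=(s',t')$. $\mathcal{O}_\theta$ is the universal C*-algebra for Cuntz-type representations, with generators $s_{e^i_t}$, and $s_w$ denotes the product of generators along a word $w$. $\mathbb{F}_\theta^+$ is aperiodic if and only if $\mathcal{O}_\theta$ is simple (this may be taken as the definition). The gauge automorphisms $\gamma_{\mathbf t}$, $\mathbf t\in\mathbb{T}^k$, are given by $\gamma_{\mathbf t}(s_w)=\mathbf t^{d(w)}s_w$; for $n\in\mathbb{Z}^k$, $\Phi_n(A)=\int_{\mathbb{T}^k}\mathbf t^{-n}\gamma_{\mathbf t}(A)\,d\mathbf t$. An element $X\in\operatorname{Ran}\Phi_n$ is said to have degree $d(X)=n$ (so $d(s_us_v^* )=d(u)-d(v)$). $\mathfrak{F}=\operatorname{Ran}\Phi_0$ is the fixed point algebra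 of the gauge action. The action $\sigma$ of $\mathbb{R}$ on $\mathcal{O}_\theta$ is given by $\sigma_t(s_us_v^* )=m^{it(d(v)-d(u))}s_us_v^*$ for $u,v\in\mathbb{F}_\theta^+$, and $\mathcal{O}_\theta^\sigma$ is its fixed point algebra. $\mathrm{C}^*(\cdot)$ denotes the C*-subalgebra of $\mathcal{O}_\theta$ generated by the indicated elements. *)

theory Defs
  imports "HOL-Analysis.Analysis" "HOL-Algebra.Ring"
begin

section \<open>Unital C*-algebras\<close>

text \<open>
  Nonzero unital C*-algebras as a type class.  The class \<open>real_normed_algebra_1\<close> supplies
  the real structure, submultiplicativity and \<open>norm 1 = 1\<close>, the class \<open>banach\<close> completeness.
\<close>

class cstar_algebra = real_normed_algebra_1 + banach +
  fixes cscale :: "complex \<Rightarrow> 'a \<Rightarrow> 'a"  (infixr "*\<^sub>C" 75)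
    and adj :: "'a \<Rightarrow> 'a"
  assumes cscale_add_right: "c *\<^sub>C (x + y) = c *\<^sub>C x + c *\<^sub>C y"
    and cscale_add_left: "(b + c) *\<^sub>C x = b *\<^sub>C x + c *\<^sub>C x"
    and cscale_cscale: "b *\<^sub>C (c *\<^sub>C x) = (b * c) *\<^sub>C x"
    and cscale_of_real: "complex_of_real r *\<^sub>C x = r *\<^sub>R x"
    and cscale_mult_left: "(c *\<^sub>C x) * y = c *\<^sub>C (x * y)"
    and cscale_mult_right: "x * (c *\<^sub>C y) = c *\<^sub>C (x * y)"
    and norm_cscale: "norm (c *\<^sub>C x) = cmod c * norm x"
    and adj_add: "adj (x + y) = adj x + adj y"
    and adj_cscale: "adj (c *\<^sub>C x) = cnj c *\<^sub>C adj x"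
    and adj_mult: "adj (x * y) = adj y * adj x"
    and adj_adj: "adj (adj x) = x"
    and cstar_identity: "norm (adj x * x) = (norm x)\<^sup>2"

text \<open>
  A universal property quantifies over C*-algebras inside a formula, where a type class cannot be
  used.  Unital C*-algebras are therefore also needed as structures with an explicit carrier.
\<close>

record 'b cstar_struct = "'b ring" +
  scale_on :: "complex \<Rightarrow> 'b \<Rightarrow> 'b"
  adj_on :: "'b \<Rightarrow> 'b"
  norm_on :: "'b \<Rightarrow> real"

locale unital_cstar = ring B for B :: "'b cstar_struct" (structure) +
  assumes scale_closed: "x \<in> carrier B \<Longrightarrow> scale_on B c x \<in> carrier B"
    and scale_add_right: "\<lbrakk>x \<in> carrier B; y \<in> carrier B\<rbrakk> \<Longrightarrow>
          scale_on B c (x \<oplus> y) = scale_on B c x \<oplus> scale_on B c y"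
    and scale_add_left: "x \<in> carrier B \<Longrightarrow>
          scale_on B (b + c) x = scale_on B b x \<oplus> scale_on B c x"
    and scale_scale: "x \<in> carrier B \<Longrightarrow> scale_on B b (scale_on B c x) = scale_on B (b * c) x"
    and scale_one: "x \<in> carrier B \<Longrightarrow> scale_on B 1 x = x"
    and scale_mult_left: "\<lbrakk>x \<in> carrier B; y \<in> carrier B\<rbrakk> \<Longrightarrow>
          scale_on B c x \<otimes> y = scale_on B c (x \<otimes> y)"
    and scale_mult_right: "\<lbrakk>x \<in> carrier B; y \<in> carrier B\<rbrakk> \<Longrightarrow>
          x \<otimes> scale_on B c y = scale_on B c (x \<otimes> y)"
    and adj_closed: "x \<in> carrier B \<Longrightarrow> adj_on B x \<in> carrier B"
    and adj_on_add: "\<lbrakk>x \<in> carrier B; y \<in> carrier B\<rbrakk> \<Longrightarrow>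
          adj_on B (x \<oplus> y) = adj_on B x \<oplus> adj_on B y"
    and adj_on_scale: "x \<in> carrier B \<Longrightarrow>
          adj_on B (scale_on B c x) = scale_on B (cnj c) (adj_on B x)"
    and adj_on_mult: "\<lbrakk>x \<in> carrier B; y \<in> carrier B\<rbrakk> \<Longrightarrow>
          adj_on B (x \<otimes> y) = adj_on B y \<otimes> adj_on B x"
    and adj_on_adj: "x \<in> carrier B \<Longrightarrow> adj_on B (adj_on B x) = x"
    and norm_on_zero_iff: "x \<in> carrier B \<Longrightarrow> norm_on B x = 0 \<longleftrightarrow> x = \<zero>"
    and norm_on_triangle: "\<lbrakk>x \<in> carrier B; y \<in> carrier B\<rbrakk> \<Longrightarrow>
          norm_on B (x \<oplus> y) \<le> norm_on B x + norm_on B y"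
    and norm_on_scale: "x \<in> carrier B \<Longrightarrow> norm_on B (scale_on B c x) = cmod c * norm_on B x"
    and norm_on_mult: "\<lbrakk>x \<in> carrier B; y \<in> carrier B\<rbrakk> \<Longrightarrow>
          norm_on B (x \<otimes> y) \<le> norm_on B x * norm_on B y"
    and norm_on_cstar: "x \<in> carrier B \<Longrightarrow> norm_on B (adj_on B x \<otimes> x) = (norm_on B x)\<^sup>2"
    and norm_on_complete: "Metric_space.mcomplete (carrier B) (\<lambda>x y. norm_on B (x \<ominus> y))"

definition whole :: "'a::cstar_algebra cstar_struct" where
  "whole = \<lparr>carrier = UNIV, mult = (*), one = 1, zero = 0, add = (+),
            scale_on = cscale, adj_on = adj, norm_on = norm\<rparr>"

lemma ring_whole: "ring (whole :: 'a::cstar_algebra cstar_struct)"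
proof (rule ringI)
  show "abelian_group (whole :: 'a cstar_struct)"
  proof (rule abelian_groupI)
    fix x :: 'a
    show "\<exists>y\<in>carrier whole. y \<oplus>\<^bsub>whole\<^esub> x = \<zero>\<^bsub>whole\<^esub>"
      by (rule bexI[of _ "- x"]) (simp_all add: whole_def)
  qed (simp_all add: whole_def add_ac)
  show "monoid (whole :: 'a cstar_struct)"
    by (rule monoidI) (simp_all add: whole_def mult.assoc)
qed (simp_all add: whole_def distrib_left distrib_right)

lemma minus_whole: "x \<ominus>\<^bsub>whole\<^esub> y = x - (y::'a::cstar_algebra)"
proof -
  interpret ring "whole :: 'a cstar_struct" by (rule ring_whole)
  have "\<ominus>\<^bsub>whole\<^esub> y = - y"
    by (rule minus_equality) (simp_all add: whole_def)
  then show ?thesis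
    by (simp add: a_minus_def) (simp add: whole_def)
qed

lemma unital_cstar_whole: "unital_cstar (whole :: 'a::cstar_algebra cstar_struct)"
proof -
  have eq: "(\<lambda>x y. norm_on whole (x \<ominus>\<^bsub>whole\<^esub> y)) = (dist :: 'a \<Rightarrow> 'a \<Rightarrow> real)"
    by (intro ext) (simp add: minus_whole, simp add: whole_def dist_norm)
  have compl: "Metric_space.mcomplete UNIV (dist :: 'a \<Rightarrow> 'a \<Rightarrow> real)"
    using complete_UNIV mcomplete_iff_complete by blast
  have one: "1 *\<^sub>C x = x" for x :: 'a
    using cscale_of_real[of 1 x] by simp
  have carr: "carrier (whole :: 'a cstar_struct) = UNIV"
    by (simp add: whole_def)
  show ?thesis
    unfolding unital_cstar_def unital_cstar_axioms_def eq carr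
    using ring_whole compl
    by (simp add: whole_def one cscale_add_right cscale_add_left cscale_cscale cscale_mult_left
        cscale_mult_right norm_cscale adj_add adj_cscale adj_mult adj_adj cstar_identity
        norm_triangle_ineq norm_mult_ineq)
qed

text \<open>
  Unital *-homomorphisms.  Between C*-algebras the norm bound holds automatically, so including it
  does not narrow the notion.
\<close>

definition star_hom :: "'a cstar_struct \<Rightarrow> 'b cstar_struct \<Rightarrow> ('a \<Rightarrow> 'b) set" where
  "star_hom A B = {\<phi> \<in> ring_hom A B.
     (\<forall>c. \<forall>x\<in>carrier A. \<phi> (scale_on A c x) = scale_on B c (\<phi> x)) \<and>
     (\<forall>x\<in>carrier A. \<phi> (adj_on A x) = adj_on B (\<phi> x)) \<and>
     (\<forall>x\<in>carrier A. norm_on B (\<phi> x) \<le> norm_on A x)}"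

definition star_automorphism :: "('a::cstar_algebra \<Rightarrow> 'a) \<Rightarrow> bool" where
  "star_automorphism \<phi> \<longleftrightarrow> \<phi> \<in> star_hom whole whole \<and> bij \<phi>"

definition cstar_subalgebra :: "'a::cstar_algebra set \<Rightarrow> bool" where
  "cstar_subalgebra B \<longleftrightarrow> 0 \<in> B \<and> (\<forall>x\<in>B. \<forall>y\<in>B. x + y \<in> B \<and> x * y \<in> B) \<and>
     (\<forall>c. \<forall>x\<in>B. c *\<^sub>C x \<in> B) \<and> (\<forall>x\<in>B. adj x \<in> B) \<and> closed B"

definition Cstar :: "'a::cstar_algebra set \<Rightarrow> 'a set" where
  "Cstar S = \<Inter>{B. cstar_subalgebra B \<and> S \<subseteq> B}"

text \<open>Since the algebra is unital, a two-sided ideal is automatically a complex subspace.\<close>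

definition closed_ideal :: "'a::cstar_algebra set \<Rightarrow> bool" where
  "closed_ideal J \<longleftrightarrow> 0 \<in> J \<and> (\<forall>x\<in>J. \<forall>y\<in>J. x + y \<in> J) \<and>
     (\<forall>a. \<forall>x\<in>J. a * x \<in> J \<and> x * a \<in> J) \<and> closed J"

definition simple_cstar :: "'a::cstar_algebra itself \<Rightarrow> bool" where
  "simple_cstar _ \<longleftrightarrow> (\<forall>J :: 'a set. closed_ideal J \<longrightarrow> J = {0} \<or> J = UNIV)"


section \<open>Single vertex k-graphs\<close>

text \<open>
  The index set \<open>{1, \<dots>, k}\<close> is rendered by a finite linearly ordered type \<open>'k\<close>, and the standard
  generator \<open>\<epsilon>\<^sub>i\<close> by \<open>axis i 1\<close>.
\<close>

locale single_vertex_kgraph =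
  fixes d :: "'l::monoid_mult \<Rightarrow> nat ^ 'k::{finite,linorder}"
  assumes deg_one: "d 1 = 0"
    and deg_mult: "d (x * y) = d x + d y"
    and factorization: "d w = p + q \<Longrightarrow> \<exists>!(u, v). w = u * v \<and> d u = p \<and> d v = q"
    and finite_edges: "finite {e. d e = axis i 1}"

definition level :: "('l \<Rightarrow> nat ^ 'k) \<Rightarrow> nat ^ 'k \<Rightarrow> 'l set" where
  "level d p = {w. d w = p}"

definition edges :: "('l \<Rightarrow> nat ^ 'k::finite) \<Rightarrow> 'k \<Rightarrow> 'l set" where
  "edges d i = level d (axis i 1)"

definition mlt :: "('l \<Rightarrow> nat ^ 'k::finite) \<Rightarrow> 'k \<Rightarrow> nat" where
  "mlt d i = card (edges d i)"

definition mpow :: "('l \<Rightarrow> nat ^ 'k::finite) \<Rightarrow> int ^ 'k \<Rightarrow> real" where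
  "mpow d p = (\<Prod>i\<in>UNIV. real (mlt d i) powi (p $ i))"

definition intrinsic_group :: "('l \<Rightarrow> nat ^ 'k::finite) \<Rightarrow> (int ^ 'k) set" where
  "intrinsic_group d = {g. mpow d g = 1}"

text \<open>The coercion \<open>nat\<close> truncates negative integers to \<open>0\<close>.\<close>

definition pos_part :: "int ^ 'k \<Rightarrow> nat ^ 'k" where
  "pos_part p = (\<chi> i. nat (p $ i))"

definition neg_part :: "int ^ 'k \<Rightarrow> nat ^ 'k" where
  "neg_part p = (\<chi> i. nat (- (p $ i)))"

definition deg_int :: "nat ^ 'k \<Rightarrow> int ^ 'k" where
  "deg_int p = (\<chi> i. int (p $ i))"

definition Z_basis :: "nat \<Rightarrow> (nat \<Rightarrow> int ^ 'k::finite) \<Rightarrow> (int ^ 'k) set \<Rightarrow> bool" where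
  "Z_basis r g G \<longleftrightarrow>
     G = {\<Sum>p\<in>{1..r}. a p *s g p | a. True} \<and>
     (\<forall>a. (\<Sum>p\<in>{1..r}. a p *s g p) = 0 \<longrightarrow> (\<forall>p\<in>{1..r}. a p = 0))"


section \<open>Cuntz-type representations and the universal algebra\<close>

definition cuntz_type :: "'b cstar_struct \<Rightarrow> 'e set \<Rightarrow> ('e \<Rightarrow> 'b) \<Rightarrow> bool" where
  "cuntz_type B I V \<longleftrightarrow> V \<in> I \<rightarrow> carrier B \<and>
     (\<forall>a\<in>I. \<forall>b\<in>I. adj_on B (V a) \<otimes>\<^bsub>B\<^esub> V b = (if a = b then \<one>\<^bsub>B\<^esub> else \<zero>\<^bsub>B\<^esub>)) \<and>
     finsum B (\<lambda>a. V a \<otimes>\<^bsub>B\<^esub> adj_on B (V a)) I = \<one>\<^bsub>B\<^esub>"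

text \<open>
  Only the values of \<open>E\<close> on edges matter.  For \<open>i < j\<close> the equation \<open>e * f = f' * e'\<close> between edges
  of the indicated degrees says exactly that \<open>\<theta>\<^sub>i\<^sub>j\<close> sends the indices of \<open>(e, f)\<close> to those of
  \<open>(e', f')\<close>.
\<close>

definition cuntz_rep ::
    "('l::monoid_mult \<Rightarrow> nat ^ 'k::{finite,linorder}) \<Rightarrow> 'b cstar_struct \<Rightarrow> ('l \<Rightarrow> 'b) \<Rightarrow> bool" where
  "cuntz_rep d B E \<longleftrightarrow> (\<forall>i. cuntz_type B (edges d i) E) \<and>
     (\<forall>i j. i < j \<longrightarrow> (\<forall>e\<in>edges d i. \<forall>f\<in>edges d j. \<forall>f'\<in>edges d j. \<forall>e'\<in>edges d i.
        e * f = f' * e' \<longrightarrow> E e \<otimes>\<^bsub>B\<^esub> E f = E f' \<otimes>\<^bsub>B\<^esub> E e'))"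

text \<open>
  The type \<open>'a\<close>, with the generators \<open>s\<close>, is the universal C*-algebra for Cuntz-type
  representations: it is generated by such a representation, and every Cuntz-type representation in
  a unital C*-algebra \<open>B\<close> factors through it (uniquely, by generation).  Letting \<open>B\<close> range over
  the C*-algebras with carrier in \<open>'a\<close> is no restriction: replacing \<open>B\<close> by the C*-subalgebra
  generated by the finitely many \<open>E e\<close>, its cardinality is at most that of the continuum, hence at
  most that of \<open>'a\<close>, so that an isomorphic copy lives on a subset of \<open>'a\<close>.
\<close>

definition is_O_theta ::
    "('l::monoid_mult \<Rightarrow> nat ^ 'k::{finite,linorder}) \<Rightarrow> ('l \<Rightarrow> 'a::cstar_algebra) \<Rightarrow> bool" where
  "is_O_theta d s \<longleftrightarrow> cuntz_rep d whole s \<and> Cstar (s ` (\<Union>i. edges d i)) = UNIV \<and>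
     (\<forall>(B :: 'a cstar_struct) E. unital_cstar B \<longrightarrow> cuntz_rep d B E \<longrightarrow>
        (\<exists>\<phi> \<in> star_hom whole B. \<forall>e \<in> (\<Union>i. edges d i). \<phi> (s e) = E e))"

text \<open>
  The product of the generators along a word, i.e. along a list of edges with product \<open>w\<close>.  By the
  commutation relations it does not depend on the list.
\<close>

definition sw :: "('l::monoid_mult \<Rightarrow> nat ^ 'k::finite) \<Rightarrow> ('l \<Rightarrow> 'a::cstar_algebra) \<Rightarrow> 'l \<Rightarrow> 'a" where
  "sw d s w = prod_list (map s (SOME es. set es \<subseteq> (\<Union>i. edges d i) \<and> prod_list es = w))"


section \<open>Gauge action, degrees and the action of the reals\<close>

definition tpow :: "complex ^ 'k::finite \<Rightarrow> int ^ 'k \<Rightarrow> complex" where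
  "tpow t n = (\<Prod>i\<in>UNIV. (t $ i) powi (n $ i))"

text \<open>The automorphism \<open>\<gamma>\<^sub>t\<close>, for \<open>t\<close> in the torus, i.e. with all \<open>t $ i\<close> of modulus one.\<close>

definition gauge ::
    "('l::monoid_mult \<Rightarrow> nat ^ 'k::finite) \<Rightarrow> ('l \<Rightarrow> 'a::cstar_algebra) \<Rightarrow> complex ^ 'k \<Rightarrow> 'a \<Rightarrow> 'a" where
  "gauge d s t = (THE \<phi>. star_automorphism \<phi> \<and>
     (\<forall>w. \<phi> (sw d s w) = tpow t (deg_int (d w)) *\<^sub>C sw d s w))"

text \<open>
  Normalized Haar measure on the torus is the image of Lebesgue measure on the unit cube under
  \<open>torus\<close>.
\<close>

definition torus :: "real ^ 'k \<Rightarrow> complex ^ 'k" where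
  "torus x = (\<chi> i. cis (2 * pi * x $ i))"

definition Phi ::
    "('l::monoid_mult \<Rightarrow> nat ^ 'k::finite) \<Rightarrow> ('l \<Rightarrow> 'a::cstar_algebra) \<Rightarrow> int ^ 'k \<Rightarrow> 'a \<Rightarrow> 'a" where
  "Phi d s n A = integral (cbox 0 1) (\<lambda>x. tpow (torus x) (- n) *\<^sub>C gauge d s (torus x) A)"

definition has_degree ::
    "('l::monoid_mult \<Rightarrow> nat ^ 'k::finite) \<Rightarrow> ('l \<Rightarrow> 'a::cstar_algebra) \<Rightarrow> 'a \<Rightarrow> int ^ 'k \<Rightarrow> bool" where
  "has_degree d s X n \<longleftrightarrow> X \<in> range (Phi d s n)"

definition core :: "('l::monoid_mult \<Rightarrow> nat ^ 'k::finite) \<Rightarrow> ('l \<Rightarrow> 'a::cstar_algebra) \<Rightarrow> 'a set" where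
  "core d s = range (Phi d s 0)"

definition sigma ::
    "('l::monoid_mult \<Rightarrow> nat ^ 'k::finite) \<Rightarrow> ('l \<Rightarrow> 'a::cstar_algebra) \<Rightarrow> real \<Rightarrow> 'a \<Rightarrow> 'a" where
  "sigma d s t = (THE \<phi>. star_automorphism \<phi> \<and>
     (\<forall>u v. \<phi> (sw d s u * adj (sw d s v)) =
        (complex_of_real (mpow d (deg_int (d v) - deg_int (d u))) powr (\<i> * complex_of_real t))
          *\<^sub>C (sw d s u * adj (sw d s v))))"

definition sigma_fixed :: "('l::monoid_mult \<Rightarrow> nat ^ 'k::finite) \<Rightarrow> ('l \<Rightarrow> 'a::cstar_algebra) \<Rightarrow> 'a set" where
  "sigma_fixed d s = {X. \<forall>t. sigma d s t X = X}"

end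

theory Submission
  imports Defs
begin

text \<open>
  Everything is expressed through the gauge automorphisms \<open>\<gamma>\<^sub>t\<close>.  They exist because
  \<open>s\<^sub>e \<mapsto> t\<^bsup>d(e)\<^esup> s\<^sub>e\<close> is again a Cuntz-type representation.  Call \<open>X\<close> homogeneous of degree \<open>n\<close> if
  \<open>\<gamma>\<^sub>t(X) = t\<^sup>n X\<close> for all \<open>t\<close> in the torus.  The homogeneous elements are closed under products and
  adjoints and include the generators, so their span is dense (\<open>closure_span_homogeneous\<close>).  By
  orthogonality of characters \<open>\<Phi>\<^sub>n\<close> is the identity on degree \<open>n\<close> and zero on every other degree, and
  by density its range is exactly the set of homogeneous elements of degree \<open>n\<close>
  (\<open>has_degree_iff_homogeneous\<close>).

  The automorphism \<open>\<sigma>\<^sub>t\<close> is the gauge automorphism at the point \<open>(m\<^sub>i\<^bsup>-it\<^esup>)\<^sub>i\<close>, hence multiplies degree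
  \<open>n\<close> by \<open>exp(-it log m\<^sup>n)\<close>; this factor is \<open>1\<close> for all \<open>t\<close> exactly when \<open>n \<in> G\<close>.  This puts the elements
  of degree in \<open>G\<close> into the fixed point algebra.  Conversely, let \<open>X\<close> be fixed and approximate it by a
  finite sum of homogeneous elements.  If one of the degrees \<open>l\<close> is not in \<open>G\<close>, then
  \<open>\<tau> = \<pi> / log m\<^sup>l\<close> makes \<open>\<sigma>\<^sub>\<tau>\<close> act on degree \<open>l\<close> as \<open>-1\<close>, so the contraction \<open>(id + \<sigma>\<^sub>\<tau>) / 2\<close> deletes the
  terms of that degree, rescales the others and fixes \<open>X\<close>.  The approximation therefore becomes no worse.
  After finitely many such steps only degrees in \<open>G\<close> are left (\<open>approximation_degrees_in_group\<close>), so
  \<open>X\<close> lies in the closed algebra that they generate.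

  For the second equality, the relations \<open>s\<^sub>u\<^sup>* s\<^sub>v = \<delta>\<^sub>u\<^sub>v\<close> and \<open>\<Sum> s\<^sub>u s\<^sub>u\<^sup>* = 1\<close> within one degree show
  that \<open>U\<^sub>p\<close> is a unitary of degree \<open>g\<^sub>p\<close> (\<open>bijection_unitary\<close>).  Degrees of unitaries form a subgroup,
  so every \<open>n \<in> G\<close> is the degree of a unitary \<open>u\<close> in \<open>C\<^sup>*(\<FF>, U\<^sub>1, \<dots>, U\<^sub>r)\<close>.  An element \<open>X\<close> of degree
  \<open>n\<close> is then \<open>(X u\<^sup>*) u\<close> with \<open>X u\<^sup>*\<close> of degree \<open>0\<close>, that is, in the core
  (\<open>Cstar_intrinsic_degrees_eq\<close>).
\<close>

section \<open>C*-algebras, generation and *-homomorphisms\<close>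

lemma cscale_one [simp]: "1 *\<^sub>C x = (x::'a::cstar_algebra)"
  using cscale_of_real[of 1 x] by simp

lemma bounded_bilinear_cscale: "bounded_bilinear (cscale :: complex \<Rightarrow> 'a::cstar_algebra \<Rightarrow> 'a)"
proof
  fix r :: real and a :: complex and x :: 'a
  have "(r *\<^sub>R a) *\<^sub>C x = of_real r *\<^sub>C (a *\<^sub>C x)"
    by (simp add: cscale_cscale scaleR_conv_of_real)
  then show "(r *\<^sub>R a) *\<^sub>C x = r *\<^sub>R (a *\<^sub>C x)"
    by (simp add: cscale_of_real)
  have "a *\<^sub>C (r *\<^sub>R x) = of_real r *\<^sub>C (a *\<^sub>C x)"
    by (simp add: cscale_of_real[symmetric] cscale_cscale mult.commute)
  then show "a *\<^sub>C (r *\<^sub>R x) = r *\<^sub>R (a *\<^sub>C x)"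
    by (simp add: cscale_of_real)
qed (auto simp: cscale_add_left cscale_add_right norm_cscale intro!: exI[of _ 1])

interpretation cscale: bounded_bilinear "cscale :: complex \<Rightarrow> 'a::cstar_algebra \<Rightarrow> 'a"
  by (rule bounded_bilinear_cscale)

lemma scaleR_cscale: "r *\<^sub>R (c *\<^sub>C (x::'a::cstar_algebra)) = c *\<^sub>C (r *\<^sub>R x)"
  by (simp add: cscale.scaleR_right)

text \<open>The C*-identity and submultiplicativity give \<open>\<parallel>x\<parallel> \<le> \<parallel>adj x\<parallel>\<close>; the involution is then isometric.\<close>

lemma norm_adj: "norm (adj (x::'a::cstar_algebra)) = norm x"
proof -
  have le: "norm y \<le> norm (adj y)" for y :: 'a
  proof (cases "norm y = 0")
    case False
    have "norm y * norm y \<le> norm (adj y) * norm y"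
      using cstar_identity[of y] norm_mult_ineq[of "adj y" y] by (simp add: power2_eq_square)
    then show ?thesis
      using False by simp
  qed auto
  show ?thesis
    using le[of x] le[of "adj x"] by (simp add: adj_adj)
qed

lemma bounded_linear_adj: "bounded_linear (adj :: 'a::cstar_algebra \<Rightarrow> 'a)"
proof
  fix r and x :: 'a
  show "adj (r *\<^sub>R x) = r *\<^sub>R adj x"
    using adj_cscale[of "of_real r" x] by (simp add: cscale_of_real)
qed (auto simp: adj_add norm_adj intro!: exI[of _ 1])

lemmas adj_zero [simp] = linear_0[OF bounded_linear.linear[OF bounded_linear_adj]]
  and adj_sum = linear_sum[OF bounded_linear.linear[OF bounded_linear_adj]]

lemma adj_one [simp]: "adj (1::'a::cstar_algebra) = 1"
  using adj_mult[of "adj 1" "1::'a"] by (simp add: adj_adj)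

lemma cstar_subalgebraD:
  assumes "cstar_subalgebra B"
  shows "0 \<in> B" "x \<in> B \<Longrightarrow> y \<in> B \<Longrightarrow> x + y \<in> B" "x \<in> B \<Longrightarrow> y \<in> B \<Longrightarrow> x * y \<in> B"
    "x \<in> B \<Longrightarrow> c *\<^sub>C x \<in> B" "x \<in> B \<Longrightarrow> adj x \<in> B" "closed B"
  using assms unfolding cstar_subalgebra_def by auto

lemma cstar_subalgebra_sum:
  assumes "cstar_subalgebra B" and "\<And>i. i \<in> I \<Longrightarrow> f i \<in> B"
  shows "sum f I \<in> B"
  using assms(2) by (induction I rule: infinite_finite_induct)
    (auto intro: cstar_subalgebraD[OF assms(1)])

lemma cstar_subalgebra_Cstar: "cstar_subalgebra (Cstar S)"
  unfolding Cstar_def cstar_subalgebra_def by (auto intro!: closed_Inter)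

lemma Cstar_superset: "S \<subseteq> Cstar S"
  unfolding Cstar_def by auto

lemma Cstar_least: "cstar_subalgebra B \<Longrightarrow> S \<subseteq> B \<Longrightarrow> Cstar S \<subseteq> B"
  unfolding Cstar_def by auto

abbreviation star_endos :: "('a::cstar_algebra \<Rightarrow> 'a) set" where
  "star_endos \<equiv> star_hom whole whole"

lemma star_hom_wholeD:
  assumes "\<phi> \<in> star_endos"
  shows "\<phi> (x + y) = \<phi> x + \<phi> y" "\<phi> (x * y) = \<phi> x * \<phi> y" "\<phi> 1 = 1" "\<phi> (c *\<^sub>C x) = c *\<^sub>C \<phi> x"
    "\<phi> (adj x) = adj (\<phi> x)" "norm (\<phi> x) \<le> norm x"
  using assms by (auto simp: star_hom_def whole_def ring_hom_def)

lemma star_hom_wholeI: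
  assumes "\<And>x y. \<phi> (x + y) = \<phi> x + \<phi> y" "\<And>x y. \<phi> (x * y) = \<phi> x * \<phi> y" "\<phi> 1 = 1"
    "\<And>c x. \<phi> (c *\<^sub>C x) = c *\<^sub>C \<phi> x" "\<And>x. \<phi> (adj x) = adj (\<phi> x)" "\<And>x. norm (\<phi> x) \<le> norm (x::'a::cstar_algebra)"
  shows "\<phi> \<in> star_endos"
  using assms by (auto simp: star_hom_def whole_def ring_hom_def)

lemma bounded_linear_star_hom:
  assumes "\<phi> \<in> star_endos"
  shows "bounded_linear \<phi>"
proof
  fix r x
  show "\<phi> (r *\<^sub>R x) = r *\<^sub>R \<phi> x"
    using star_hom_wholeD(4)[OF assms, of "of_real r" x] by (simp add: cscale_of_real)
qed (auto simp: star_hom_wholeD[OF assms] intro!: exI[of _ 1])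

lemma continuous_star_hom:
  assumes "\<phi> \<in> star_endos"
  shows "continuous_on A \<phi>"
  using bounded_linear_star_hom[OF assms] by (simp add: linear_continuous_on)

lemma star_hom_id: "(\<lambda>x. x) \<in> star_endos"
  by (rule star_hom_wholeI) auto

lemma star_hom_comp:
  assumes "\<phi> \<in> star_endos" "\<psi> \<in> star_endos"
  shows "(\<lambda>x. \<phi> (\<psi> x)) \<in> star_endos"
  using star_hom_wholeD[OF assms(1)] star_hom_wholeD[OF assms(2)]
  by (intro star_hom_wholeI) (auto intro: order_trans[OF star_hom_wholeD(6)[OF assms(1)]])

lemma star_hom_equalizer:
  assumes "\<phi> \<in> star_endos" "\<psi> \<in> star_endos"
  shows "cstar_subalgebra {x. \<phi> x = \<psi> x}"
proof -
  have "\<phi> 0 = 0" "\<psi> 0 = 0"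
    using bounded_linear_star_hom[OF assms(1)] bounded_linear_star_hom[OF assms(2)]
    by (simp_all add: linear_0 bounded_linear.linear)
  moreover have "closed {x. \<phi> x = \<psi> x}"
    by (intro closed_Collect_eq continuous_star_hom assms)
  ultimately show ?thesis
    using star_hom_wholeD[OF assms(1)] star_hom_wholeD[OF assms(2)]
    by (auto simp: cstar_subalgebra_def)
qed

text \<open>
  The set on which two *-homomorphisms agree is a C*-subalgebra, so agreement on generators suffices.
\<close>

lemma star_hom_eqI:
  assumes "\<phi> \<in> star_endos" "\<psi> \<in> star_endos"
    and "Cstar S = UNIV" and "\<And>x. x \<in> S \<Longrightarrow> \<phi> x = \<psi> x"
  shows "\<phi> = \<psi>"
proof
  have "Cstar S \<subseteq> {x. \<phi> x = \<psi> x}"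
    using star_hom_equalizer[OF assms(1,2)] assms(4) by (intro Cstar_least) auto
  then show "\<phi> x = \<psi> x" for x
    using assms(3) by auto
qed

text \<open>
  \<^term>\<open>cuntz_type\<close> is phrased with the finite sum of the record structure, which for \<^term>\<open>whole\<close>
  is the sum of the type class.
\<close>

lemma finsum_whole: "finite I \<Longrightarrow> finsum whole f I = (\<Sum>a\<in>I. f a :: 'a::cstar_algebra)"
proof (induction I rule: finite_induct)
  interpret ring "whole :: 'a cstar_struct" by (rule ring_whole)
  case empty
  show ?case by (simp add: finsum_empty) (simp add: whole_def)
next
  interpret ring "whole :: 'a cstar_struct" by (rule ring_whole)
  case (insert x F)
  have "f \<in> F \<rightarrow> carrier whole" "f x \<in> carrier whole"
    by (auto simp: whole_def)
  then show ?case
    using insert by (simp add: finsum_insert) (simp add: whole_def)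
qed

lemma cuntz_type_whole:
  assumes "finite I"
  shows "cuntz_type whole I V \<longleftrightarrow>
    (\<forall>a\<in>I. \<forall>b\<in>I. adj (V a) * V b = (if a = b then 1 else (0::'a::cstar_algebra))) \<and>
    (\<Sum>a\<in>I. V a * adj (V a)) = 1"
  unfolding cuntz_type_def finsum_whole[OF assms] by (auto simp: whole_def finsum_whole[OF assms])

section \<open>Words in a single vertex k-graph\<close>

definition deg_size :: "nat ^ 'k::finite \<Rightarrow> nat" where
  "deg_size p = (\<Sum>i\<in>UNIV. p $ i)"

lemma deg_size_simps [simp]: "deg_size (p + q :: nat ^ 'k::finite) = deg_size p + deg_size q"
  "deg_size (axis i (1::nat) :: nat ^ 'k::finite) = 1"
  "deg_size (axis i (Suc 0) :: nat ^ 'k::finite) = Suc 0"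
  "deg_size (0 :: nat ^ 'k::finite) = 0"
proof -
  show "deg_size (p + q :: nat ^ 'k) = deg_size p + deg_size q"
    by (simp add: deg_size_def sum.distrib)
  show "deg_size (0 :: nat ^ 'k) = 0"
    by (simp add: deg_size_def)
  show "deg_size (axis i (Suc 0) :: nat ^ 'k) = Suc 0"
    by (simp add: deg_size_def axis_def)
  show "deg_size (axis i (1::nat) :: nat ^ 'k) = 1"
    by (simp add: deg_size_def axis_def)
qed

lemma split_degree:
  assumes "(p :: nat ^ 'k::finite) \<noteq> 0"
  obtains i q where "p = axis i 1 + q"
proof -
  obtain i where i: "p $ i \<noteq> 0"
    using assms by (auto simp: vec_eq_iff)
  have "p = axis i 1 + (\<chi> l. p $ l - (if l = i then 1 else 0))"
    using i by (auto simp: vec_eq_iff axis_def)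
  then show ?thesis
    by (rule that)
qed

text \<open>
  Words are built by appending one edge at a time; this is the matching induction on degrees.
\<close>

lemma degree_induct [case_names zero step]:
  assumes "P 0" and "\<And>q i. P q \<Longrightarrow> P (q + axis i 1)"
  shows "P (p :: nat ^ 'k::finite)"
proof (induction "deg_size p" arbitrary: p rule: less_induct)
  case less
  show ?case
  proof (cases "p = 0")
    case False
    then obtain i q where p: "p = axis i 1 + q"
      by (rule split_degree)
    have "deg_size q < deg_size p"
      using p by simp
    from assms(2)[OF less[OF this], of i] show ?thesis
      using p by (simp add: add.commute)
  qed (use assms in simp)
qed

context single_vertex_kgraph
begin

definition edge_set :: "'l set" where
  "edge_set = (\<Union>i. edges d i)"

definition edge_word :: "'l list \<Rightarrow> bool" where
  "edge_word es \<longleftrightarrow> set es \<subseteq> edge_set"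

lemma edge_word_simps [simp]:
  "edge_word []" "edge_word (e # es) \<longleftrightarrow> e \<in> edge_set \<and> edge_word es"
  "edge_word (es @ fs) \<longleftrightarrow> edge_word es \<and> edge_word fs"
  by (auto simp: edge_word_def)

lemma edges_iff: "e \<in> edges d i \<longleftrightarrow> d e = axis i 1"
  by (simp add: edges_def level_def)

lemma edge_set_iff: "e \<in> edge_set \<longleftrightarrow> (\<exists>i. d e = axis i 1)"
  by (auto simp: edge_set_def edges_iff)

lemma finite_edges_at: "finite (edges d i)"
  using finite_edges[of i] by (simp add: edges_def level_def)

lemma factor_ex:
  assumes "d w = p + q"
  obtains u v where "w = u * v" "d u = p" "d v = q"
  using factorization[OF assms] by auto

lemma factor_unique:
  assumes "u * v = u' * v'" "d u = d u'"
  shows "u = u'" "v = v'"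
proof -
  have "d u + d v = d u' + d v'"
    using assms by (metis deg_mult)
  then have dv: "d v = d v'"
    using assms(2) by simp
  obtain z where z: "\<And>y. (case y of (a, b) \<Rightarrow> u * v = a * b \<and> d a = d u \<and> d b = d v) \<Longrightarrow> y = z"
    using factorization[OF deg_mult[of u v]] by (auto elim!: ex1E)
  show "u = u'" "v = v'"
    using z[of "(u, v)"] z[of "(u', v')"] assms dv by auto
qed

text \<open>
  \<open>w * 1 = 1 * w\<close> are two factorizations of \<open>w\<close> with both degrees zero.
\<close>

lemma deg_zero_imp_one:
  assumes "d w = 0"
  shows "w = 1"
  using factor_unique(1)[of w 1 1 w] assms by (simp add: deg_one)

lemma edge_word_ex: "\<exists>es. edge_word es \<and> prod_list es = w"
proof (induction "deg_size (d w)" arbitrary: w)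
  case 0
  then have "d w = 0"
    by (simp add: deg_size_def vec_eq_iff)
  then show ?case
    using deg_zero_imp_one by (intro exI[of _ "[]"]) simp
next
  case (Suc n)
  then have "d w \<noteq> 0"
    by (auto simp: deg_size_def)
  then obtain i q where iq: "d w = axis i 1 + q"
    by (rule split_degree)
  then obtain e v where ev: "w = e * v" "d e = axis i 1" "d v = q"
    by (rule factor_ex)
  have "n = deg_size (d v)"
    using Suc(2) iq ev by simp
  then obtain es where "edge_word es" "prod_list es = v"
    using Suc(1) by blast
  then show ?case
    using ev by (intro exI[of _ "e # es"]) (auto simp: edge_set_iff)
qed

text \<open>
  Two edge words for the same element can be connected by the commutation squares: if their first
  edges \<open>e\<close>, \<open>f\<close> have different degrees, the element can be written as \<open>e * f' * w = f * e' * w\<close>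
  with \<open>e * f' = f * e'\<close>, and induction on the total degree applies to the two remainders.
\<close>

lemma prod_list_edge_word_cong:
  fixes E :: "'l \<Rightarrow> 'b::monoid_mult"
  assumes comm: "\<And>i j e f f' e'. i < j \<Longrightarrow> e \<in> edges d i \<Longrightarrow> f \<in> edges d j \<Longrightarrow> f' \<in> edges d j \<Longrightarrow>
      e' \<in> edges d i \<Longrightarrow> e * f = f' * e' \<Longrightarrow> E e * E f = E f' * E e'"
    and "edge_word es" "edge_word fs" "prod_list es = prod_list fs"
  shows "prod_list (map E es) = prod_list (map E fs)"
  using assms(2-)
proof (induction "deg_size (d (prod_list es))" arbitrary: es fs rule: less_induct)
  case less
  have size_edge: "deg_size (d e) = 1" if "e \<in> edge_set" for e
    using that by (auto simp: edge_set_iff)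
  show ?case
  proof (cases es)
    case Nil
    show ?thesis
    proof (cases fs)
      case (Cons f fs')
      have "deg_size (d 1) = deg_size (d f) + deg_size (d (prod_list fs'))"
        using less.prems Nil Cons by (metis deg_mult list.simps(8) prod_list.Cons prod_list.Nil deg_size_simps(1))
      then have False
        using less.prems(2) Cons size_edge by (simp add: deg_one)
      then show ?thesis ..
    qed (use Nil in simp)
  next
    case (Cons e es')
    note es = this
    show ?thesis
    proof (cases fs)
      case Nil
      have "deg_size (d 1) = deg_size (d e) + deg_size (d (prod_list es'))"
        using less.prems Nil es by (metis deg_mult list.simps(8) prod_list.Cons prod_list.Nil deg_size_simps(1))
      then have False
        using less.prems(1) es size_edge by (simp add: deg_one)
      then show ?thesis ..
    next
      case (Cons f fs')
      note fs = this
      have e: "e \<in> edge_set" "edge_word es'" and f: "f \<in> edge_set" "edge_word fs'"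
        using less.prems es fs by auto
      have eq: "e * prod_list es' = f * prod_list fs'"
        using less.prems es fs by simp
      have deg_es: "d (prod_list es) = d e + d (prod_list es')"
        "d (prod_list es) = d f + d (prod_list fs')"
        by (simp add: es deg_mult) (simp add: es eq deg_mult)
      have small: "deg_size (d (prod_list es')) < deg_size (d (prod_list es))"
        "deg_size (d (prod_list fs')) < deg_size (d (prod_list es))"
        using deg_es(1)[THEN arg_cong, of deg_size] deg_es(2)[THEN arg_cong, of deg_size]
          size_edge[OF e(1)] size_edge[OF f(1)] by simp_all
      obtain i j where ij: "d e = axis i 1" "d f = axis j 1"
        using e f by (auto simp: edge_set_iff)
      show ?thesis
      proof (cases "i = j")
        case True
        then have "e = f" "prod_list es' = prod_list fs'"
          using factor_unique[OF eq] ij by auto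
        then show ?thesis
          using less.hyps[OF small(1) e(2) f(2)] es fs by simp
      next
        case False
        have "d (prod_list es') $ j = Suc (d (prod_list fs') $ j)"
          using arg_cong[OF trans[OF deg_es(1)[symmetric] deg_es(2)], of "\<lambda>p. p $ j"] ij False
          by (simp add: axis_def)
        then have "d (prod_list es') = axis j 1 + (\<chi> l. d (prod_list es') $ l - (if l = j then 1 else 0))"
          by (simp add: vec_eq_iff axis_def)
        then obtain f' w where f': "prod_list es' = f' * w" "d f' = axis j 1"
          by (rule factor_ex)
        have "d (e * f') = axis j 1 + axis i 1"
          unfolding deg_mult ij f' by (rule add.commute)
        then obtain f'' e' where e': "e * f' = f'' * e'" "d f'' = axis j 1" "d e' = axis i 1"
          by (rule factor_ex)
        have "f'' * (e' * w) = f * prod_list fs'"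
          using eq f' e' by (metis mult.assoc)
        then have fs': "f'' = f" "e' * w = prod_list fs'"
          using factor_unique[of f'' "e' * w" f "prod_list fs'"] ij e' by auto
        obtain ws where ws: "edge_word ws" "prod_list ws = w"
          using edge_word_ex by blast
        have in_edges: "edge_word (f' # ws)" "edge_word (e' # ws)"
          using f'(2) e'(3) ws(1) by (auto simp: edge_set_iff)
        have prods: "prod_list es' = prod_list (f' # ws)" "prod_list fs' = prod_list (e' # ws)"
          using ws(2) f'(1) fs'(2) by simp_all
        have "prod_list (map E es') = prod_list (map E (f' # ws))"
          by (rule less.hyps[OF small(1) e(2) in_edges(1) prods(1)])
        moreover have "prod_list (map E fs') = prod_list (map E (e' # ws))"
          by (rule less.hyps[OF small(2) f(2) in_edges(2) prods(2)])
        moreover have "E e * E f' = E f * E e'"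
        proof (cases "i < j")
          case True
          show ?thesis
            using comm[OF True, of e f' f e'] ij f' e' fs' by (simp add: edges_iff)
        next
          case False
          then have "j < i"
            using \<open>i \<noteq> j\<close> by simp
          from comm[OF this, of f e' e f'] show ?thesis
            using ij f' e' fs' by (simp add: edges_iff)
        qed
        ultimately show ?thesis
          by (simp add: es fs mult.assoc[symmetric])
      qed
    qed
  qed
qed

end

section \<open>Characters of the torus\<close>

definition unit_torus :: "(complex ^ 'k::finite) set" where
  "unit_torus = {t. \<forall>i. cmod (t $ i) = 1}"

lemma unit_torus_nz: "t \<in> unit_torus \<Longrightarrow> t $ i \<noteq> 0"
  by (auto simp: unit_torus_def dest!: spec[of _ i])

lemma torus_in_unit_torus: "torus x \<in> unit_torus"
  by (simp add: unit_torus_def torus_def)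

lemma tpow_zero [simp]: "tpow t 0 = 1"
  by (simp add: tpow_def)

lemma tpow_add: "t \<in> unit_torus \<Longrightarrow> tpow t (m + n) = tpow t m * tpow t n"
  by (simp add: tpow_def power_int_add unit_torus_nz prod.distrib)

lemma norm_tpow: "t \<in> unit_torus \<Longrightarrow> cmod (tpow t n) = 1"
  by (simp add: tpow_def prod_norm[symmetric] norm_power_int unit_torus_def)

lemma cnj_tpow: "t \<in> unit_torus \<Longrightarrow> cnj (tpow t n) = tpow t (- n)"
proof -
  assume t: "t \<in> unit_torus"
  have "tpow t n * tpow t (- n) = 1"
    using tpow_add[OF t, of n "- n"] by simp
  moreover have "cnj (tpow t n) * tpow t n = 1"
    using norm_tpow[OF t, of n] complex_norm_square[of "tpow t n"] by (simp add: mult.commute)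
  ultimately show ?thesis
    by (metis mult.assoc mult.commute mult_1)
qed

lemma cnj_unit_torus: "t \<in> unit_torus \<Longrightarrow> (\<chi> i. cnj (t $ i)) \<in> unit_torus"
  by (simp add: unit_torus_def)

lemma tpow_cnj: "tpow (\<chi> i. cnj (t $ i)) n = cnj (tpow t n)"
  by (simp add: tpow_def)

lemma deg_int_add: "deg_int (p + q) = deg_int p + deg_int q"
  by (simp add: deg_int_def vec_eq_iff)

lemma deg_int_zero [simp]: "deg_int 0 = 0"
  by (simp add: deg_int_def vec_eq_iff)

lemma pos_part_minus_neg_part: "deg_int (pos_part g) - deg_int (neg_part g) = g"
  by (simp add: deg_int_def pos_part_def neg_part_def vec_eq_iff)


section \<open>Isometries attached to words\<close>

lemma cuntz_rep_whole:
  fixes E :: "'l::monoid_mult \<Rightarrow> 'a::cstar_algebra"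
  shows "cuntz_rep d whole E \<longleftrightarrow> (\<forall>i. cuntz_type whole (edges d i) E) \<and>
     (\<forall>i j. i < j \<longrightarrow> (\<forall>e\<in>edges d i. \<forall>f\<in>edges d j. \<forall>f'\<in>edges d j. \<forall>e'\<in>edges d i.
        e * f = f' * e' \<longrightarrow> E e * E f = E f' * E e'))"
proof -
  have "x \<otimes>\<^bsub>whole\<^esub> y = x * y" for x y :: 'a
    by (simp add: whole_def)
  then show ?thesis
    unfolding cuntz_rep_def by (simp only:)
qed

locale cuntz_algebra = single_vertex_kgraph d for d :: "'l::monoid_mult \<Rightarrow> nat ^ 'k::{finite,linorder}" +
  fixes s :: "'l \<Rightarrow> 'a::cstar_algebra"
  assumes O_theta: "is_O_theta d s"
begin

lemma s_isometry: "e \<in> edges d i \<Longrightarrow> f \<in> edges d i \<Longrightarrow> adj (s e) * s f = (if e = f then 1 else 0)"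
  and s_sum: "(\<Sum>e\<in>edges d i. s e * adj (s e)) = 1"
  using O_theta unfolding is_O_theta_def cuntz_rep_def cuntz_type_whole[OF finite_edges_at] by auto

lemma s_commute:
  "i < j \<Longrightarrow> e \<in> edges d i \<Longrightarrow> f \<in> edges d j \<Longrightarrow> f' \<in> edges d j \<Longrightarrow> e' \<in> edges d i \<Longrightarrow>
    e * f = f' * e' \<Longrightarrow> s e * s f = s f' * s e'"
  using O_theta unfolding is_O_theta_def cuntz_rep_whole by blast

lemma generated: "Cstar (s ` edge_set) = UNIV"
  using O_theta by (simp add: is_O_theta_def edge_set_def)

lemma sw_eq_prod_list:
  assumes "edge_word es" "prod_list es = w"
  shows "sw d s w = prod_list (map s es)"
proof -
  let ?fs = "SOME es. set es \<subseteq> (\<Union>i. edges d i) \<and> prod_list es = w"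
  have "set ?fs \<subseteq> (\<Union>i. edges d i) \<and> prod_list ?fs = w"
    by (rule someI[of _ es]) (use assms in \<open>simp add: edge_word_def edge_set_def\<close>)
  then have "edge_word ?fs" "prod_list ?fs = prod_list es"
    using assms by (simp_all add: edge_word_def edge_set_def)
  then show ?thesis
    unfolding sw_def by (intro prod_list_edge_word_cong s_commute assms)
qed

lemma sw_one [simp]: "sw d s 1 = 1"
  using sw_eq_prod_list[of "[]" 1] by simp

lemma sw_edge: "e \<in> edge_set \<Longrightarrow> sw d s e = s e"
  using sw_eq_prod_list[of "[e]" e] by simp

lemma sw_edges: "e \<in> edges d i \<Longrightarrow> sw d s e = s e"
  by (rule sw_edge) (auto simp: edge_set_def)

lemma sw_mult: "sw d s (u * v) = sw d s u * sw d s v"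
proof -
  obtain es fs where "edge_word es" "prod_list es = u" "edge_word fs" "prod_list fs = v"
    using edge_word_ex by metis
  then show ?thesis
    using sw_eq_prod_list[of "es @ fs"] sw_eq_prod_list[of es] sw_eq_prod_list[of fs] by simp
qed

lemma level_factor:
  assumes "w \<in> level d (q + axis i 1)"
  obtains u e where "w = u * e" "u \<in> level d q" "e \<in> edges d i"
  using assms by (auto simp: level_def edges_iff elim!: factor_ex)

lemma bij_betw_level:
  "bij_betw (\<lambda>(u, e). u * e) (level d q \<times> edges d i) (level d (q + axis i 1))"
  unfolding bij_betw_def
proof
  show "inj_on (\<lambda>(u, e). u * e) (level d q \<times> edges d i)"
    by (auto simp: inj_on_def level_def dest: factor_unique)
  show "(\<lambda>(u, e). u * e) ` (level d q \<times> edges d i) = level d (q + axis i 1)"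
  proof
    show "(\<lambda>(u, e). u * e) ` (level d q \<times> edges d i) \<subseteq> level d (q + axis i 1)"
      by (auto simp: level_def edges_iff deg_mult)
    show "level d (q + axis i 1) \<subseteq> (\<lambda>(u, e). u * e) ` (level d q \<times> edges d i)"
    proof
      fix w assume "w \<in> level d (q + axis i 1)"
      then obtain u e where "w = u * e" "u \<in> level d q" "e \<in> edges d i"
        by (rule level_factor)
      then show "w \<in> (\<lambda>(u, e). u * e) ` (level d q \<times> edges d i)"
        by (intro image_eqI[of _ _ "(u, e)"]) auto
    qed
  qed
qed

lemma level_zero: "level d 0 = {1}"
  using deg_zero_imp_one by (auto simp: level_def deg_one)

lemma finite_level: "finite (level d p)"
proof (induction p rule: degree_induct)
  case (step q i)
  then show ?case
    using bij_betw_finite[OF bij_betw_level[of q i]] finite_edges_at[of i] by simp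
qed (simp add: level_zero)

lemma sw_isometry: "u \<in> level d p \<Longrightarrow> v \<in> level d p \<Longrightarrow> adj (sw d s u) * sw d s v = (if u = v then 1 else 0)"
proof (induction p arbitrary: u v rule: degree_induct)
  case (step q i)
  obtain u1 e where u: "u = u1 * e" "u1 \<in> level d q" "e \<in> edges d i"
    using step.prems(1) by (rule level_factor)
  obtain v1 f where v: "v = v1 * f" "v1 \<in> level d q" "f \<in> edges d i"
    using step.prems(2) by (rule level_factor)
  have ef: "sw d s e = s e" "sw d s f = s f"
    using u v by (simp_all add: sw_edges)
  have "adj (sw d s u) * sw d s v = adj (s e) * (adj (sw d s u1) * sw d s v1) * s f"
    by (simp add: u v sw_mult adj_mult mult.assoc ef)
  also have "\<dots> = (if u1 = v1 \<and> e = f then 1 else 0)"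
    using step.IH[OF u(2) v(2)] s_isometry[OF u(3) v(3)] by auto
  also have "(u1 = v1 \<and> e = f) \<longleftrightarrow> u = v"
    using u v factor_unique[of u1 e v1 f] by (auto simp: level_def)
  finally show ?case .
qed (simp add: level_zero)

text \<open>
  Every word of degree \<open>q + \<epsilon>\<^sub>i\<close> is uniquely \<open>u e\<close>, and the inner sum over the edges \<open>e\<close> collapses by
  the Cuntz relation.
\<close>

lemma sw_sum: "(\<Sum>u\<in>level d p. sw d s u * adj (sw d s u)) = 1"
proof (induction p rule: degree_induct)
  case (step q i)
  have "(\<Sum>w\<in>level d (q + axis i 1). sw d s w * adj (sw d s w))
      = (\<Sum>(u, e)\<in>level d q \<times> edges d i. sw d s (u * e) * adj (sw d s (u * e)))"
    by (subst sum.reindex_bij_betw[OF bij_betw_level, symmetric]) (simp add: case_prod_beta)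
  also have "\<dots> = (\<Sum>u\<in>level d q. \<Sum>e\<in>edges d i. sw d s (u * e) * adj (sw d s (u * e)))"
    by (simp add: sum.cartesian_product)
  also have "\<dots> = (\<Sum>u\<in>level d q. sw d s u * (\<Sum>e\<in>edges d i. s e * adj (s e)) * adj (sw d s u))"
    by (intro sum.cong refl)
      (simp add: sum_distrib_left sum_distrib_right sw_mult adj_mult mult.assoc sw_edges
        cong: sum.cong)
  also have "\<dots> = 1"
    using step by (simp add: s_sum)
  finally show ?case .
qed (simp add: level_zero)

section \<open>The gauge action\<close>

text \<open>
  The rescaled generators satisfy the same relations: the scalars have modulus one, and both sides of a
  commutation square carry the same scalar because they have the same degree.
\<close>

lemma gauge_ex:
  assumes t: "t \<in> unit_torus"
  shows "\<exists>\<phi>\<in>star_endos. \<forall>w. \<phi> (sw d s w) = tpow t (deg_int (d w)) *\<^sub>C sw d s w"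
proof -
  let ?c = "\<lambda>e. tpow t (deg_int (d e))"
  let ?E = "\<lambda>e. ?c e *\<^sub>C s e"
  have c: "cnj (?c e) * ?c e = 1" "?c e * cnj (?c e) = 1" for e
    using norm_tpow[OF t] complex_norm_square[of "?c e"] by (simp_all add: mult.commute)
  have cuntz: "cuntz_type whole (edges d i) ?E" for i
  proof -
    have "adj (?E e) * ?E f = (if e = f then 1 else 0)" if "e \<in> edges d i" "f \<in> edges d i" for e f
    proof -
      have "adj (?E e) * ?E f = (cnj (?c e) * ?c f) *\<^sub>C (adj (s e) * s f)"
        by (simp add: adj_cscale cscale_mult_left cscale_mult_right cscale_cscale mult.commute)
      then show ?thesis
        using s_isometry[OF that] c by (auto simp: cscale.zero_right)
    qed
    moreover have "?E e * adj (?E e) = s e * adj (s e)" for e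
      by (simp add: adj_cscale cscale_mult_left cscale_mult_right cscale_cscale c)
    ultimately show ?thesis
      using s_sum[of i] by (simp add: cuntz_type_whole[OF finite_edges_at])
  qed
  have comm: "?E e * ?E f = ?E f' * ?E e'"
    if "i < j" "e \<in> edges d i" "f \<in> edges d j" "f' \<in> edges d j" "e' \<in> edges d i" "e * f = f' * e'"
    for i j e f f' e'
  proof -
    have "?c e * ?c f = ?c f' * ?c e'"
      using arg_cong[OF that(6), of d] by (simp add: deg_mult tpow_add[OF t, symmetric] deg_int_add[symmetric])
    then show ?thesis
      using s_commute[OF that] by (simp add: cscale_mult_left cscale_mult_right cscale_cscale mult.commute)
  qed
  have "cuntz_rep d whole ?E"
    unfolding cuntz_rep_whole
    by (intro conjI allI impI ballI cuntz) (rule comm, assumption+)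
  then have "\<exists>\<phi>\<in>star_endos. \<forall>e\<in>edge_set. \<phi> (s e) = ?E e"
    using O_theta unital_cstar_whole unfolding is_O_theta_def edge_set_def by (elim conjE allE impE)
  then obtain \<phi> where \<phi>: "\<phi> \<in> star_endos" "\<And>e. e \<in> edge_set \<Longrightarrow> \<phi> (s e) = ?E e"
    by auto
  have "\<phi> (prod_list (map s es)) = tpow t (deg_int (d (prod_list es))) *\<^sub>C prod_list (map s es)"
    if "edge_word es" for es
    using that
  proof (induction es)
    case Nil
    then show ?case
      using star_hom_wholeD(3)[OF \<phi>(1)] by (simp add: deg_one)
  next
    case (Cons e es)
    then show ?case
      by (simp add: star_hom_wholeD(2)[OF \<phi>(1)] \<phi>(2) deg_mult deg_int_add tpow_add[OF t]
          cscale_mult_left cscale_mult_right cscale_cscale mult.commute)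
  qed
  then have "\<phi> (sw d s w) = tpow t (deg_int (d w)) *\<^sub>C sw d s w" for w
    using edge_word_ex[of w] sw_eq_prod_list by metis
  then show ?thesis
    using \<phi>(1) by blast
qed

lemma star_endos_eqI:
  assumes "\<phi> \<in> star_endos" "\<psi> \<in> star_endos" "\<And>w. \<phi> (sw d s w) = \<psi> (sw d s w)"
  shows "\<phi> = (\<psi> :: 'a \<Rightarrow> 'a)"
  using assms(3) by (intro star_hom_eqI[OF assms(1,2) generated]) (metis imageE sw_edge)

text \<open>
  The endomorphism belonging to the conjugate point is inverse to the given one.
\<close>

lemma gauge_automorphism_ex:
  assumes t: "t \<in> unit_torus"
  shows "\<exists>\<phi>. star_automorphism \<phi> \<and> (\<forall>w. \<phi> (sw d s w) = tpow t (deg_int (d w)) *\<^sub>C sw d s w)"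
proof -
  obtain \<phi> where \<phi>: "\<phi> \<in> star_endos" "\<And>w. \<phi> (sw d s w) = tpow t (deg_int (d w)) *\<^sub>C sw d s w"
    using gauge_ex[OF t] by blast
  obtain \<psi> where \<psi>: "\<psi> \<in> star_endos" "\<And>w. \<psi> (sw d s w) = cnj (tpow t (deg_int (d w))) *\<^sub>C sw d s w"
    using gauge_ex[OF cnj_unit_torus[OF t]] by (auto simp: tpow_cnj)
  have c: "cnj (tpow t n) * tpow t n = 1" "tpow t n * cnj (tpow t n) = 1" for n
    using norm_tpow[OF t, of n] complex_norm_square[of "tpow t n"] by (simp_all add: mult.commute)
  have "(\<lambda>x. \<phi> (\<psi> x)) = (\<lambda>x. x)"
    by (rule star_endos_eqI[OF star_hom_comp[OF \<phi>(1) \<psi>(1)] star_hom_id])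
      (simp add: \<phi>(2) \<psi>(2) star_hom_wholeD(4)[OF \<phi>(1)] cscale_cscale c)
  moreover have "(\<lambda>x. \<psi> (\<phi> x)) = (\<lambda>x. x)"
    by (rule star_endos_eqI[OF star_hom_comp[OF \<psi>(1) \<phi>(1)] star_hom_id])
      (simp add: \<phi>(2) \<psi>(2) star_hom_wholeD(4)[OF \<psi>(1)] cscale_cscale c)
  ultimately have "bij \<phi>"
    by (intro o_bij[of \<psi>]) (auto simp: fun_eq_iff)
  then show ?thesis
    using \<phi> by (intro exI[of _ \<phi>]) (simp add: star_automorphism_def)
qed

lemma gauge_eqI:
  assumes "star_automorphism \<phi>" "\<And>w. \<phi> (sw d s w) = tpow t (deg_int (d w)) *\<^sub>C sw d s w"
  shows "gauge d s t = \<phi>"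
  unfolding gauge_def
proof (rule the_equality)
  fix \<psi> assume "star_automorphism \<psi> \<and> (\<forall>w. \<psi> (sw d s w) = tpow t (deg_int (d w)) *\<^sub>C sw d s w)"
  then show "\<psi> = \<phi>"
    using assms by (intro star_endos_eqI) (auto simp: star_automorphism_def)
qed (use assms in blast)

lemma
  assumes "t \<in> unit_torus"
  shows gauge_automorphism: "star_automorphism (gauge d s t)"
    and gauge_sw: "gauge d s t (sw d s w) = tpow t (deg_int (d w)) *\<^sub>C sw d s w"
proof -
  obtain \<phi> where \<phi>: "star_automorphism \<phi>" "\<And>w. \<phi> (sw d s w) = tpow t (deg_int (d w)) *\<^sub>C sw d s w"
    using gauge_automorphism_ex[OF assms] by blast
  then have "gauge d s t = \<phi>"
    by (rule gauge_eqI)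
  then show "star_automorphism (gauge d s t)" "gauge d s t (sw d s w) = tpow t (deg_int (d w)) *\<^sub>C sw d s w"
    using \<phi> by simp_all
qed

lemma gauge_endo: "t \<in> unit_torus \<Longrightarrow> gauge d s t \<in> star_endos"
  using gauge_automorphism by (simp add: star_automorphism_def)

lemmas gauge_simps = star_hom_wholeD[OF gauge_endo]
  and bounded_linear_gauge = bounded_linear_star_hom[OF gauge_endo]

end

section \<open>Integrals of characters over the torus\<close>

text \<open>
  In the coordinates of the cube every character is a product of one-dimensional characters, so its
  integral is a product by Fubini.
\<close>

lemma tpow_torus: "tpow (torus x) n = (\<Prod>i\<in>UNIV. cis (2 * pi * of_int (n $ i) * (x $ i)))"
  by (simp add: tpow_def torus_def cis_power_int mult_ac)

lemma continuous_tpow_torus: "continuous_on A (\<lambda>x. tpow (torus x) n)"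
  unfolding tpow_torus by (intro continuous_intros)

lemma integral_circle_character:
  assumes "m \<noteq> 0"
  shows "integral {0..1} (\<lambda>y. cis (2 * pi * of_int m * y)) = 0"
proof -
  let ?c = "2 * pi * of_int m :: real"
  have c: "?c \<noteq> 0"
    using assms by simp
  have "((\<lambda>y. cis (?c * y)) has_integral cis (?c * 1) / (\<i> * ?c) - cis (?c * 0) / (\<i> * ?c)) {0..1}"
  proof (rule fundamental_theorem_of_calculus)
    fix x :: real
    have "((\<lambda>y. exp (\<i> * ?c * of_real y) / (\<i> * ?c)) has_vector_derivative exp (\<i> * ?c * of_real x)) (at x within {0..1})"
      using c by (auto intro!: derivative_eq_intros has_vector_derivative_real_field)
    then show "((\<lambda>y. cis (?c * y) / (\<i> * ?c)) has_vector_derivative cis (?c * x)) (at x within {0..1})"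
      by (simp add: cis_conv_exp mult_ac)
  qed simp
  moreover have "cis ?c = 1"
    using cis_multiple_2pi[of "of_int m"] by simp
  ultimately show ?thesis
    by (simp add: integral_unique)
qed

lemma lborel_integral_prod:
  fixes f :: "'b::euclidean_space \<Rightarrow> real \<Rightarrow> complex"
  assumes "\<And>b. b \<in> Basis \<Longrightarrow> integrable lborel (f b)"
  shows "(LINT x|lborel. (\<Prod>b\<in>Basis. f b (x \<bullet> b))) = (\<Prod>b\<in>Basis. LINT y|lborel. f b y)"
proof -
  interpret product_sigma_finite "\<lambda>_::'b. lborel :: real measure" ..
  have [measurable]: "f b \<in> borel_measurable borel" if "b \<in> Basis" for b
    using borel_measurable_integrable[OF assms[OF that]] by simp
  have "(LINT x|lborel. (\<Prod>b\<in>Basis. f b (x \<bullet> b)))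
      = (LINT y|(\<Pi>\<^sub>M b\<in>Basis. lborel). (\<Prod>b\<in>Basis. f b ((\<Sum>c\<in>Basis. y c *\<^sub>R c) \<bullet> b)))"
    by (subst lborel_eq, subst integral_distr) simp_all
  also have "\<dots> = (LINT y|(\<Pi>\<^sub>M b\<in>Basis. lborel). (\<Prod>b\<in>Basis. f b (y b)))"
    by (simp cong: prod.cong)
  also have "\<dots> = (\<Prod>b\<in>Basis. LINT y|lborel. f b y)"
    by (rule product_integral_prod) (simp_all add: assms)
  finally show ?thesis .
qed

lemma content_unit_cube: "Henstock_Kurzweil_Integration.content (cbox 0 1 :: (real ^ 'k::finite) set) = 1"
proof -
  have "(0 :: real ^ 'k) \<in> cbox 0 1"
    by (simp add: mem_box_cart)
  then have "cbox 0 1 \<noteq> ({} :: (real ^ 'k) set)"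
    by blast
  then show ?thesis
    by (simp add: content_cbox_cart)
qed

lemma integral_torus_character:
  fixes n :: "int ^ 'k::finite"
  shows "integral (cbox 0 1) (\<lambda>x. tpow (torus x) n) = (if n = 0 then 1 else 0)"
proof (cases "n = 0")
  case False
  then obtain k where k: "n $ k \<noteq> 0"
    by (auto simp: vec_eq_iff)
  define h where "h b y = indicator {0..1} y *\<^sub>R cis (2 * pi * of_int (n $ axis_index b) * y)"
    for b :: "real ^ 'k" and y :: real
  have h: "integrable lborel (h b)" for b
    unfolding h_def by (intro borel_integrable_compact continuous_intros) auto
  have basis: "(\<Prod>b\<in>Basis. F b) = (\<Prod>i\<in>UNIV. F (axis i 1))" for F :: "real ^ 'k \<Rightarrow> complex"
  proof -
    have eq: "(Basis :: (real ^ 'k) set) = range (\<lambda>i. axis i 1)"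
      by (auto simp: Basis_vec_def)
    have inj: "inj (\<lambda>i. axis i 1 :: real ^ 'k)"
      by (simp add: inj_on_def axis_eq_axis)
    show ?thesis
      unfolding eq by (simp add: prod.reindex[OF inj])
  qed
  have prod_h: "indicator (cbox 0 1) x *\<^sub>R tpow (torus x) n = (\<Prod>b\<in>Basis. h b (x \<bullet> b))" for x
  proof (cases "x \<in> cbox 0 1")
    case True
    then show ?thesis
      by (simp add: basis h_def tpow_torus axis_index_axis inner_axis mem_box_cart)
  next
    case False
    then obtain i where "\<not> (0 \<le> x $ i \<and> x $ i \<le> 1)"
      by (auto simp: mem_box_cart)
    then have "h (axis i 1) (x \<bullet> axis i 1) = 0"
      by (simp add: h_def inner_axis indicator_def)
    then have "(\<Prod>b\<in>Basis. h b (x \<bullet> b)) = 0"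
      unfolding basis by (intro prod_zero) auto
    then show ?thesis
      using False by simp
  qed
  have int: "integrable lborel (\<lambda>x. indicator (cbox 0 1) x *\<^sub>R tpow (torus x) n)"
    by (intro borel_integrable_compact compact_cbox continuous_tpow_torus)
  have "integral (cbox 0 1) (\<lambda>x. tpow (torus x) n) = (LINT x|lborel. indicator (cbox 0 1) x *\<^sub>R tpow (torus x) n)"
    using set_borel_integral_eq_integral(2)[of "cbox 0 1" "\<lambda>x. tpow (torus x) n"] int
    by (simp add: set_integrable_def set_lebesgue_integral_def)
  also have "\<dots> = (\<Prod>b\<in>Basis. LINT y|lborel. h b y)"
    unfolding prod_h using h by (rule lborel_integral_prod)
  also have "\<dots> = 0"
  proof -
    have "(LINT y|lborel. h (axis k 1) y) = integral {0..1} (\<lambda>y. cis (2 * pi * of_int (n $ k) * y))"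
      using set_borel_integral_eq_integral(2)[of "{0..1}" "\<lambda>y. cis (2 * pi * of_int (n $ k) * y)"] h[of "axis k 1"]
      unfolding h_def by (simp add: set_integrable_def set_lebesgue_integral_def axis_index_axis)
    also have "\<dots> = 0"
      using k by (rule integral_circle_character)
    finally show ?thesis
      unfolding basis by (intro prod_zero) auto
  qed
  finally show ?thesis
    using False by simp
qed (simp add: content_unit_cube)

context cuntz_algebra
begin

section \<open>Homogeneous elements\<close>

definition homogeneous :: "(int, 'k) vec \<Rightarrow> 'a \<Rightarrow> bool" where
  "homogeneous n X \<longleftrightarrow> (\<forall>t\<in>unit_torus. gauge d s t X = tpow t n *\<^sub>C X)"

lemma homogeneousD: "homogeneous n X \<Longrightarrow> t \<in> unit_torus \<Longrightarrow> gauge d s t X = tpow t n *\<^sub>C X"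
  by (simp add: homogeneous_def)

lemma homogeneous_sw: "homogeneous (deg_int (d w)) (sw d s w)"
  by (simp add: homogeneous_def gauge_sw)

lemma homogeneous_zero [simp]: "homogeneous n 0"
  by (simp add: homogeneous_def linear_0[OF bounded_linear.linear[OF bounded_linear_gauge]] cscale.zero_right)

lemma homogeneous_one: "homogeneous 0 1"
  by (simp add: homogeneous_def gauge_simps)

lemma homogeneous_add: "homogeneous n X \<Longrightarrow> homogeneous n Y \<Longrightarrow> homogeneous n (X + Y)"
  by (simp add: homogeneous_def gauge_simps cscale_add_right)

lemma homogeneous_cscale: "homogeneous n X \<Longrightarrow> homogeneous n (c *\<^sub>C X)"
  by (simp add: homogeneous_def gauge_simps cscale_cscale mult.commute)

lemma homogeneous_scaleR: "homogeneous n X \<Longrightarrow> homogeneous n (c *\<^sub>R X)"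
  using homogeneous_cscale[of n X "of_real c"] by (simp add: cscale_of_real)

lemma homogeneous_mult: "homogeneous m X \<Longrightarrow> homogeneous n Y \<Longrightarrow> homogeneous (m + n) (X * Y)"
  by (simp add: homogeneous_def gauge_simps tpow_add cscale_mult_left cscale_mult_right cscale_cscale mult.commute)

lemma homogeneous_adj: "homogeneous n X \<Longrightarrow> homogeneous (- n) (adj X)"
  by (simp add: homogeneous_def gauge_simps adj_cscale cnj_tpow)

lemma homogeneous_sum: "(\<And>i. i \<in> I \<Longrightarrow> homogeneous n (f i)) \<Longrightarrow> homogeneous n (sum f I)"
  by (induction I rule: infinite_finite_induct) (auto intro: homogeneous_add)

lemma closed_homogeneous: "closed {X. homogeneous n X}"
proof -
  have "{X. homogeneous n X} = (\<Inter>t\<in>unit_torus. {X. gauge d s t X = tpow t n *\<^sub>C X})"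
    by (auto simp: homogeneous_def)
  moreover have "closed {X. gauge d s t X = tpow t n *\<^sub>C X}" if "t \<in> unit_torus" for t
    by (intro closed_Collect_eq continuous_star_hom gauge_endo that
        linear_continuous_on cscale.bounded_linear_right)
  ultimately show ?thesis
    by auto
qed

lemma subspace_homogeneous: "subspace {X. homogeneous n X}"
  by (auto simp: subspace_def homogeneous_add homogeneous_scaleR)

lemma span_homogeneous_mult:
  assumes "x \<in> span {X. \<exists>n. homogeneous n X}" "y \<in> span {X. \<exists>n. homogeneous n X}"
  shows "x * y \<in> span {X. \<exists>n. homogeneous n X}"
  using assms(1)
proof (rule span_induct)
  show "subspace {x. x * y \<in> span {X. \<exists>n. homogeneous n X}}"
    by (auto simp: subspace_def span_zero distrib_right span_add span_scale)
  fix x assume x: "x \<in> {X. \<exists>n. homogeneous n X}"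
  show "x * y \<in> span {X. \<exists>n. homogeneous n X}"
    using assms(2)
  proof (rule span_induct)
    show "subspace {y. x * y \<in> span {X. \<exists>n. homogeneous n X}}"
      by (auto simp: subspace_def span_zero distrib_left span_add span_scale)
    show "x * y \<in> span {X. \<exists>n. homogeneous n X}" if "y \<in> {X. \<exists>n. homogeneous n X}" for y
      using x that by (auto intro!: span_base dest: homogeneous_mult)
  qed
qed

lemma span_homogeneous_image:
  assumes "bounded_linear f" "\<And>n X. homogeneous n X \<Longrightarrow> \<exists>m. homogeneous m (f X)"
    "x \<in> span {X. \<exists>n. homogeneous n X}"
  shows "f x \<in> span {X. \<exists>n. homogeneous n X}"
  using assms(3)
proof (rule span_induct)
  note linear = bounded_linear.linear[OF assms(1)]
  show "subspace {x. f x \<in> span {X. \<exists>n. homogeneous n X}}"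
    by (auto simp: subspace_def span_zero linear_0[OF linear] linear_add[OF linear] linear_scale[OF linear]
        span_add span_scale)
  show "f x \<in> span {X. \<exists>n. homogeneous n X}" if "x \<in> {X. \<exists>n. homogeneous n X}" for x
    using that assms(2) by (auto intro!: span_base)
qed

text \<open>
  Products and adjoints of homogeneous elements are homogeneous, so the closed span is a
  C*-subalgebra; it contains the generators.
\<close>

lemma closure_span_homogeneous: "closure (span {X. \<exists>n. homogeneous n X}) = UNIV"
proof -
  let ?H = "span {X. \<exists>n. homogeneous n X}"
  have image: "f x \<in> closure ?H" if "bounded_linear f" "\<And>x. x \<in> ?H \<Longrightarrow> f x \<in> ?H" "x \<in> closure ?H" for f x
  proof -
    have "f ` closure ?H \<subseteq> closure ?H"
      using that(2) by (intro image_closure_subset linear_continuous_on that(1) closed_closure)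
        (auto intro: subsetD[OF closure_subset])
    then show ?thesis
      using that by auto
  qed
  have add_mult: "x + y \<in> closure ?H \<and> x * y \<in> closure ?H"
    if x: "x \<in> closure ?H" and y: "y \<in> closure ?H" for x y
  proof -
    obtain f g where fg: "\<And>n. f n \<in> ?H" "f \<longlonglongrightarrow> x" "\<And>n. g n \<in> ?H" "g \<longlonglongrightarrow> y"
      using x y unfolding closure_sequential by blast
    have "(\<lambda>n. f n * g n) \<longlonglongrightarrow> x * y" "\<And>n. f n * g n \<in> ?H"
      "(\<lambda>n. f n + g n) \<longlonglongrightarrow> x + y" "\<And>n. f n + g n \<in> ?H"
      using fg by (auto intro: tendsto_mult tendsto_add span_homogeneous_mult span_add)
    then show ?thesis
      unfolding closure_sequential
      by (intro conjI exI[of _ "\<lambda>n. f n * g n"] exI[of _ "\<lambda>n. f n + g n"]) simp_all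
  qed
  have "cstar_subalgebra (closure ?H)"
    unfolding cstar_subalgebra_def
  proof (intro conjI ballI allI)
    show "0 \<in> closure ?H"
      by (intro subsetD[OF closure_subset] span_zero)
    show "c *\<^sub>C x \<in> closure ?H" if "x \<in> closure ?H" for c x
      using that by (intro image[OF cscale.bounded_linear_right] span_homogeneous_image[OF cscale.bounded_linear_right])
        (auto intro: homogeneous_cscale)
    show "adj x \<in> closure ?H" if "x \<in> closure ?H" for x
      using that by (intro image[OF bounded_linear_adj] span_homogeneous_image[OF bounded_linear_adj])
        (auto intro: homogeneous_adj)
  qed (auto dest: add_mult)
  moreover have "s ` edge_set \<subseteq> closure ?H"
  proof safe
    fix e assume "e \<in> edge_set"
    then have "homogeneous (deg_int (d e)) (s e)"
      using homogeneous_sw[of e] by (simp add: sw_edge)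
    then show "s e \<in> closure ?H"
      by (intro subsetD[OF closure_subset] span_base) auto
  qed
  ultimately have "Cstar (s ` edge_set) \<subseteq> closure ?H"
    by (rule Cstar_least)
  then show ?thesis
    using generated by auto
qed

text \<open>
  The density statement in the form of an induction principle: a closed condition that is stable
  under linear combinations only has to be checked on homogeneous elements.
\<close>

lemma closed_subspace_contains_all:
  assumes "closed V" "subspace V" "\<And>n X. homogeneous n X \<Longrightarrow> X \<in> V"
  shows "X \<in> V"
proof -
  have "span {X. \<exists>n. homogeneous n X} \<subseteq> V"
    using assms(2,3) by (intro span_minimal) auto
  then have "closure (span {X. \<exists>n. homogeneous n X}) \<subseteq> V"
    using assms(1) by (rule closure_minimal)
  then show ?thesis
    using closure_span_homogeneous by auto
qed

section \<open>The spectral subspaces\<close>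

lemma norm_gauge_le: "t \<in> unit_torus \<Longrightarrow> norm (gauge d s t A) \<le> norm A"
  by (rule gauge_simps)

lemma gauge_diff: "t \<in> unit_torus \<Longrightarrow> gauge d s t (A - B) = gauge d s t A - gauge d s t B"
  using linear_diff[OF bounded_linear.linear[OF bounded_linear_gauge]] .

lemma linear_gauge_torus: "linear (gauge d s (torus x))"
  by (intro bounded_linear.linear bounded_linear_gauge torus_in_unit_torus)

text \<open>
  For homogeneous \<open>A\<close> the orbit is a character times \<open>A\<close>.  Since gauge automorphisms are contractive,
  convergence \<open>A\<^sub>n \<longlonglongrightarrow> A\<close> makes the orbit maps converge uniformly, so continuity passes to limits.
\<close>

lemma continuous_gauge_torus: "continuous_on S (\<lambda>x. gauge d s (torus x) A)"
proof -
  let ?V = "{A. continuous_on S (\<lambda>x. gauge d s (torus x) A)}"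
  have "A \<in> ?V"
  proof (rule closed_subspace_contains_all)
    show "closed ?V"
      unfolding closed_sequential_limits
    proof (intro allI impI, elim conjE)
      fix f B assume f: "\<forall>n. f n \<in> ?V" and lim: "f \<longlonglongrightarrow> B"
      have "uniform_limit S (\<lambda>n x. gauge d s (torus x) (f n)) (\<lambda>x. gauge d s (torus x) B) sequentially"
        unfolding uniform_limit_iff
      proof (intro allI impI)
        fix e :: real assume "e > 0"
        then have "\<forall>\<^sub>F n in sequentially. dist (f n) B < e"
          using lim tendstoD by blast
        then show "\<forall>\<^sub>F n in sequentially. \<forall>x\<in>S. dist (gauge d s (torus x) (f n)) (gauge d s (torus x) B) < e"
        proof (eventually_elim, intro ballI)
          fix n x assume "dist (f n) B < e"
          then show "dist (gauge d s (torus x) (f n)) (gauge d s (torus x) B) < e"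
            using norm_gauge_le[OF torus_in_unit_torus, of x "f n - B"]
            by (simp add: dist_norm gauge_diff torus_in_unit_torus)
        qed
      qed
      then show "B \<in> ?V"
        using uniform_limit_theorem[where F = sequentially and A = S and f = "\<lambda>n x. gauge d s (torus x) (f n)"] f by auto
    qed
    show "subspace ?V"
      by (auto simp: subspace_def linear_0[OF linear_gauge_torus] linear_add[OF linear_gauge_torus]
          linear_scale[OF linear_gauge_torus] intro!: continuous_intros)
    show "X \<in> ?V" if "homogeneous n X" for n X
      using that by (auto simp: homogeneousD torus_in_unit_torus
          intro!: cscale.continuous_on continuous_tpow_torus continuous_intros)
  qed
  then show ?thesis by simp
qed

lemma continuous_Phi_integrand: "continuous_on S (\<lambda>x. tpow (torus x) n *\<^sub>C gauge d s (torus x) A)"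
  by (intro cscale.continuous_on continuous_tpow_torus continuous_gauge_torus)

lemma Phi_has_integral:
  "((\<lambda>x. tpow (torus x) (- n) *\<^sub>C gauge d s (torus x) A) has_integral Phi d s n A) (cbox 0 1)"
  unfolding Phi_def by (intro integrable_integral integrable_continuous continuous_Phi_integrand)

lemma bounded_linear_Phi: "bounded_linear (Phi d s n)"
proof
  fix A B :: 'a and r :: real
  have "((\<lambda>x. tpow (torus x) (- n) *\<^sub>C gauge d s (torus x) (A + B)) has_integral Phi d s n A + Phi d s n B) (cbox 0 1)"
    using has_integral_add[OF Phi_has_integral[of n A] Phi_has_integral[of n B]]
    by (simp add: linear_add[OF linear_gauge_torus] cscale_add_right)
  then show "Phi d s n (A + B) = Phi d s n A + Phi d s n B"
    unfolding Phi_def[of d s n "A + B"] by (rule integral_unique)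
  have "((\<lambda>x. tpow (torus x) (- n) *\<^sub>C gauge d s (torus x) (r *\<^sub>R A)) has_integral r *\<^sub>R Phi d s n A) (cbox 0 1)"
    using has_integral_cmul[OF Phi_has_integral[of n A], of r]
    by (simp add: linear_scale[OF linear_gauge_torus] scaleR_cscale)
  then show "Phi d s n (r *\<^sub>R A) = r *\<^sub>R Phi d s n A"
    unfolding Phi_def[of d s n "r *\<^sub>R A"] by (rule integral_unique)
  show "\<exists>K. \<forall>x. norm (Phi d s n x) \<le> norm x * K"
  proof (intro exI allI)
    fix A :: 'a
    show "norm (Phi d s n A) \<le> norm A * Henstock_Kurzweil_Integration.content (cbox 0 1 :: (real, 'k) vec set)"
      by (rule has_integral_bound[OF _ Phi_has_integral])
        (simp_all add: norm_cscale norm_tpow torus_in_unit_torus norm_gauge_le)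
  qed
qed

lemma Phi_homogeneous:
  assumes "homogeneous m A"
  shows "Phi d s n A = (if m = n then A else 0)"
proof -
  have "Phi d s n A = integral (cbox 0 1) (\<lambda>x. tpow (torus x) (m - n) *\<^sub>C A)"
    unfolding Phi_def
    using tpow_add[OF torus_in_unit_torus, of _ "- n" m]
    by (simp add: homogeneousD[OF assms] torus_in_unit_torus cscale_cscale)
  also have "\<dots> = integral (cbox 0 1) (\<lambda>x. tpow (torus x) (m - n)) *\<^sub>C A"
    using integral_linear[OF integrable_continuous[OF continuous_tpow_torus] cscale.bounded_linear_left[of A]]
    by (simp add: o_def)
  finally show ?thesis
    by (simp add: integral_torus_character cscale.zero_left)
qed

text \<open>
  True for homogeneous \<open>A\<close> by orthogonality of characters, hence for all \<open>A\<close> by density; this replaces the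
  usual argument by translation invariance of Haar measure.
\<close>

lemma homogeneous_Phi: "homogeneous n (Phi d s n A)"
proof -
  have "A \<in> Phi d s n -` {X. homogeneous n X}"
  proof (rule closed_subspace_contains_all)
    show "closed (Phi d s n -` {X. homogeneous n X})"
      by (intro closed_vimage closed_homogeneous linear_continuous_on bounded_linear_Phi)
    show "subspace (Phi d s n -` {X. homogeneous n X})"
      by (intro linear_subspace_vimage bounded_linear.linear[OF bounded_linear_Phi] subspace_homogeneous)
    show "X \<in> Phi d s n -` {X. homogeneous n X}" if "homogeneous m X" for m X
      using that by (auto simp: Phi_homogeneous)
  qed
  then show ?thesis by simp
qed

lemma has_degree_iff_homogeneous: "has_degree d s X n \<longleftrightarrow> homogeneous n X"
  unfolding has_degree_def using homogeneous_Phi Phi_homogeneous[of n X n]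
  by (metis imageE rangeI)

lemma core_eq: "core d s = {X. homogeneous 0 X}"
  using has_degree_iff_homogeneous[of _ 0] by (auto simp: core_def has_degree_def)

section \<open>The action of the reals\<close>

lemma mlt_pos: "mlt d i > 0"
proof -
  have "edges d i \<noteq> {}"
    using s_sum[of i] by auto
  then show ?thesis
    by (simp add: mlt_def card_gt_0_iff finite_edges_at)
qed

lemma mpow_pos: "mpow d n > 0"
  unfolding mpow_def by (intro prod_pos) (simp add: mlt_pos)

lemma ln_mpow: "ln (mpow d n) = (\<Sum>i\<in>UNIV. of_int (n $ i) * ln (real (mlt d i)))"
proof -
  have "ln (real (mlt d i) powi k) = of_int k * ln (real (mlt d i))" for i k
    using mlt_pos[of i] by (simp flip: powr_real_of_int' add: ln_powr)
  then show ?thesis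
    unfolding mpow_def using mlt_pos by (subst ln_prod) (auto simp: power_int_eq_0_iff)
qed

text \<open>
  The point \<open>(m\<^sub>i\<^bsup>-it\<^esup>)\<^sub>i\<close> of the torus, at which the gauge automorphism is \<open>\<sigma>\<^sub>t\<close>.
\<close>

definition sigma_point :: "real \<Rightarrow> (complex, 'k) vec" where
  "sigma_point t = (\<chi> i. cis (- t * ln (real (mlt d i))))"

lemma sigma_point_in_torus: "sigma_point t \<in> unit_torus"
  by (simp add: sigma_point_def unit_torus_def)

lemma prod_cis: "(\<Prod>i\<in>I. cis (f i)) = cis (\<Sum>i\<in>I. f i)"
  by (induction I rule: infinite_finite_induct) (simp_all add: cis_mult)

lemma tpow_sigma_point: "tpow (sigma_point t) n = cis (- t * ln (mpow d n))"
  by (simp add: tpow_def sigma_point_def cis_power_int prod_cis ln_mpow sum_distrib_left sum_negf mult_ac)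

lemma mpow_powr: "complex_of_real (mpow d n) powr (\<i> * complex_of_real t) = tpow (sigma_point t) (- n)"
proof -
  have "ln (mpow d (- n)) = - ln (mpow d n)"
    by (simp add: ln_mpow sum_negf)
  then show ?thesis
    using mpow_pos[of n]
    by (simp add: tpow_sigma_point powr_def Ln_of_real cis_conv_exp mult_ac)
qed

lemma sigma_eq_gauge: "sigma d s t = gauge d s (sigma_point t)"
  unfolding sigma_def
proof (rule the_equality, intro conjI allI)
  show "star_automorphism (gauge d s (sigma_point t))"
    by (intro gauge_automorphism sigma_point_in_torus)
  show "gauge d s (sigma_point t) (sw d s u * adj (sw d s v)) =
    (complex_of_real (mpow d (deg_int (d v) - deg_int (d u))) powr (\<i> * complex_of_real t)) *\<^sub>C
      (sw d s u * adj (sw d s v))" for u v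
    using homogeneousD[OF homogeneous_mult[OF homogeneous_sw homogeneous_adj[OF homogeneous_sw]] sigma_point_in_torus]
    by (simp add: mpow_powr)
next
  fix \<phi>
  assume \<phi>: "star_automorphism \<phi> \<and> (\<forall>u v. \<phi> (sw d s u * adj (sw d s v)) =
        (complex_of_real (mpow d (deg_int (d v) - deg_int (d u))) powr (\<i> * complex_of_real t))
          *\<^sub>C (sw d s u * adj (sw d s v)))"
  have "\<phi> (sw d s w) = tpow (sigma_point t) (deg_int (d w)) *\<^sub>C sw d s w" for w
    using conjunct2[OF \<phi>, THEN spec, THEN spec, of w 1] by (simp add: mpow_powr deg_one)
  then show "\<phi> = gauge d s (sigma_point t)"
    using gauge_eqI[of \<phi>] \<phi> by simp
qed

lemma sigma_homogeneous: "homogeneous n X \<Longrightarrow> sigma d s t X = cis (- t * ln (mpow d n)) *\<^sub>C X"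
  unfolding sigma_eq_gauge tpow_sigma_point[symmetric] by (rule homogeneousD[OF _ sigma_point_in_torus])

lemma sigma_endo: "sigma d s t \<in> star_endos"
  unfolding sigma_eq_gauge by (rule gauge_endo[OF sigma_point_in_torus])

lemma mem_intrinsic_group_iff: "n \<in> intrinsic_group d \<longleftrightarrow> ln (mpow d n) = 0"
  using mpow_pos[of n] by (simp add: intrinsic_group_def)

lemma cstar_subalgebra_sigma_fixed: "cstar_subalgebra (sigma_fixed d s)"
proof -
  have "sigma_fixed d s = (\<Inter>t. {X. sigma d s t X = X})"
    by (auto simp: sigma_fixed_def)
  moreover have "cstar_subalgebra {X. sigma d s t X = X}" for t
    by (rule star_hom_equalizer[OF sigma_endo star_hom_id])
  ultimately show ?thesis
    by (auto simp: cstar_subalgebra_def intro!: closed_INT)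
qed

lemma homogeneous_sigma_fixed:
  assumes "n \<in> intrinsic_group d" "homogeneous n X"
  shows "X \<in> sigma_fixed d s"
  using assms by (simp add: sigma_fixed_def sigma_homogeneous mem_intrinsic_group_iff)

text \<open>
  The averaging step that removes one degree \<open>m\<close> outside the intrinsic group from an approximation of
  \<open>X\<close>.  The map \<open>A\<close> in the proof is a contraction that fixes \<open>X\<close> and acts on each homogeneous
  component as a scalar, so components that already vanish stay zero.
\<close>

lemma sigma_average_kill:
  assumes X: "X \<in> sigma_fixed d s" and Y: "\<And>i. i \<in> I \<Longrightarrow> homogeneous (n i) (Y i)"
    and m: "m \<notin> intrinsic_group d"
  shows "\<exists>Z. (\<forall>i\<in>I. homogeneous (n i) (Z i) \<and> (Y i = 0 \<longrightarrow> Z i = 0) \<and> (n i = m \<longrightarrow> Z i = 0)) \<and>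
    norm (X - (\<Sum>i\<in>I. Z i)) \<le> norm (X - (\<Sum>i\<in>I. Y i))"
proof -
  \<comment> \<open>Chosen so that \<open>\<sigma>\<^sub>\<tau>\<close> multiplies degree \<open>m\<close> by \<open>exp(-i\<pi>) = -1\<close>.\<close>
  define \<tau> where "\<tau> = pi / ln (mpow d m)"
  define A where "A Z = (1/2) *\<^sub>R (Z + sigma d s \<tau> Z)" for Z
  have lin: "linear (sigma d s \<tau>)"
    by (intro bounded_linear.linear bounded_linear_star_hom sigma_endo)
  have A_sum: "A (\<Sum>i\<in>I. f i) = (\<Sum>i\<in>I. A (f i))" for f
    by (simp add: A_def linear_sum[OF lin] sum.distrib scaleR_add_right scaleR_sum_right)
  have A_diff: "A (Z - W) = A Z - A W" for Z W
    by (simp add: A_def linear_diff[OF lin] algebra_simps)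
  have norm_A: "norm (A Z) \<le> norm Z" for Z
    using norm_triangle_ineq[of Z "sigma d s \<tau> Z"] star_hom_wholeD(6)[OF sigma_endo, of \<tau> Z]
    by (simp add: A_def)
  have "A X = X"
    using X by (simp add: A_def sigma_fixed_def scaleR_add_right[symmetric] scaleR_2[symmetric])
  then have "norm (X - (\<Sum>i\<in>I. A (Y i))) = norm (A (X - (\<Sum>i\<in>I. Y i)))"
    by (simp add: A_diff A_sum)
  then have dist: "norm (X - (\<Sum>i\<in>I. A (Y i))) \<le> norm (X - (\<Sum>i\<in>I. Y i))"
    using norm_A by simp
  have hom: "homogeneous (n i) (A (Y i))" if "i \<in> I" for i
    unfolding A_def sigma_homogeneous[OF Y[OF that]]
    by (intro homogeneous_scaleR homogeneous_add homogeneous_cscale Y that)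
  have zero: "A (Y i) = 0" if "i \<in> I" "Y i = 0" for i
    using that by (simp add: A_def linear_0[OF lin])
  have kill: "A (Y i) = 0" if "i \<in> I" "n i = m" for i
  proof -
    have cis_minus_pi: "cis (- pi) = - 1"
      by (simp add: complex_eq_iff)
    have "- \<tau> * ln (mpow d m) = - pi"
      using m by (simp add: \<tau>_def mem_intrinsic_group_iff)
    then have "sigma d s \<tau> (Y i) = - Y i"
      unfolding sigma_homogeneous[OF Y[OF that(1)]] that(2)
      by (simp add: cis_minus_pi cscale.minus_left)
    then show ?thesis
      by (simp add: A_def)
  qed
  show ?thesis
    using dist hom zero kill by (intro exI[of _ "\<lambda>i. A (Y i)"]) blast
qed

text \<open>
  The averaging step is applied for each index in \<open>J\<close> whose degree lies outside the group; the distance to \<open>X\<close> never grows.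
\<close>

lemma approximation_degrees_in_group:
  assumes X: "X \<in> sigma_fixed d s" and "finite J" "J \<subseteq> I"
    and Y: "\<And>i. i \<in> I \<Longrightarrow> homogeneous (n i) (Y i)"
  shows "\<exists>Z. (\<forall>i\<in>I. homogeneous (n i) (Z i)) \<and> (\<forall>i\<in>J. n i \<notin> intrinsic_group d \<longrightarrow> Z i = 0) \<and>
    norm (X - (\<Sum>i\<in>I. Z i)) \<le> norm (X - (\<Sum>i\<in>I. Y i))"
  using assms(2,3)
proof (induction J rule: finite_induct)
  case empty
  show ?case
    using Y by (intro exI[of _ Y]) auto
next
  case (insert j J)
  then obtain Z where Z: "\<And>i. i \<in> I \<Longrightarrow> homogeneous (n i) (Z i)"
    "\<And>i. i \<in> J \<Longrightarrow> n i \<notin> intrinsic_group d \<Longrightarrow> Z i = 0"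
    "norm (X - (\<Sum>i\<in>I. Z i)) \<le> norm (X - (\<Sum>i\<in>I. Y i))"
    by auto
  show ?case
  proof (cases "n j \<in> intrinsic_group d")
    case True
    then show ?thesis
      using Z by (intro exI[of _ Z]) auto
  next
    case False
    obtain W where W: "\<And>i. i \<in> I \<Longrightarrow> homogeneous (n i) (W i)" "\<And>i. i \<in> I \<Longrightarrow> Z i = 0 \<Longrightarrow> W i = 0"
      "\<And>i. i \<in> I \<Longrightarrow> n i = n j \<Longrightarrow> W i = 0" "norm (X - (\<Sum>i\<in>I. W i)) \<le> norm (X - (\<Sum>i\<in>I. Z i))"
      using sigma_average_kill[where I = I and Y = Z and n = n, OF X Z(1) False] by auto
    show ?thesis
    proof (intro exI[of _ W] conjI ballI impI)
      show "W i = 0" if "i \<in> insert j J" "n i \<notin> intrinsic_group d" for i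
        using that W(2,3) Z(2) insert.prems by (cases "i = j") auto
    qed (use W(1,4) Z(3) in auto)
  qed
qed

lemma sigma_fixed_eq:
  "sigma_fixed d s = Cstar {X. \<exists>n\<in>intrinsic_group d. homogeneous n X}" (is "_ = Cstar ?S")
proof
  show "Cstar ?S \<subseteq> sigma_fixed d s"
    by (intro Cstar_least cstar_subalgebra_sigma_fixed) (auto intro: homogeneous_sigma_fixed)
  show "sigma_fixed d s \<subseteq> Cstar ?S"
  proof
    fix X assume X: "X \<in> sigma_fixed d s"
    have "\<exists>Z\<in>Cstar ?S. dist Z X < e" if "e > 0" for e
    proof -
      have "X \<in> closure (span {X. \<exists>n. homogeneous n X})"
        by (simp add: closure_span_homogeneous)
      then obtain Y where Y: "Y \<in> span {X. \<exists>n. homogeneous n X}" "dist Y X < e"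
        using \<open>e > 0\<close> unfolding closure_approachable by blast
      then obtain T c where T: "finite T" "T \<subseteq> {X. \<exists>n. homogeneous n X}" "Y = (\<Sum>a\<in>T. c a *\<^sub>R a)"
        unfolding span_explicit by blast
      then have "\<forall>a\<in>T. \<exists>n. homogeneous n (c a *\<^sub>R a)"
        by (auto intro: homogeneous_scaleR)
      then obtain n where n: "\<And>a. a \<in> T \<Longrightarrow> homogeneous (n a) (c a *\<^sub>R a)"
        by metis
      obtain Z where Z: "\<And>a. a \<in> T \<Longrightarrow> homogeneous (n a) (Z a)"
        "\<And>a. a \<in> T \<Longrightarrow> n a \<notin> intrinsic_group d \<Longrightarrow> Z a = 0" "norm (X - (\<Sum>a\<in>T. Z a)) \<le> norm (X - Y)"
        using approximation_degrees_in_group[where n = n and Y = "\<lambda>a. c a *\<^sub>R a", OF X T(1) order_refl n]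
        unfolding T(3) by auto
      have "Z a \<in> Cstar ?S" if "a \<in> T" for a
      proof (cases "n a \<in> intrinsic_group d")
        case True
        then show ?thesis
          using Z(1)[OF that] by (intro subsetD[OF Cstar_superset]) auto
      next
        case False
        then show ?thesis
          using Z(2)[OF that] cstar_subalgebraD(1)[OF cstar_subalgebra_Cstar] by simp
      qed
      then have "(\<Sum>a\<in>T. Z a) \<in> Cstar ?S"
        by (intro cstar_subalgebra_sum cstar_subalgebra_Cstar)
      moreover have "dist (\<Sum>a\<in>T. Z a) X < e"
        using Z(3) Y(2) by (simp add: dist_norm norm_minus_commute)
      ultimately show ?thesis by blast
    qed
    then have "X \<in> closure (Cstar ?S)"
      by (simp add: closure_approachable)
    then show "X \<in> Cstar ?S"
      by (simp add: closure_closed[OF cstar_subalgebraD(6)[OF cstar_subalgebra_Cstar]])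
  qed
qed

section \<open>Unitaries of prescribed degree\<close>

text \<open>
  These degrees form a subgroup when \<open>B\<close> is a unital C*-subalgebra, which reduces the search for
  unitaries of degree in \<open>G\<close> to a basis.
\<close>

definition unitary_degrees :: "'a set \<Rightarrow> (int, 'k) vec set" where
  "unitary_degrees B = {n. \<exists>u\<in>B. homogeneous n u \<and> adj u * u = 1 \<and> u * adj u = 1}"

lemma unitary_degrees_add:
  assumes B: "cstar_subalgebra B" and "m \<in> unitary_degrees B" "n \<in> unitary_degrees B"
  shows "m + n \<in> unitary_degrees B"
proof -
  obtain u v where uv: "u \<in> B" "homogeneous m u" "adj u * u = 1" "u * adj u = 1"
    "v \<in> B" "homogeneous n v" "adj v * v = 1" "v * adj v = 1"
    using assms(2,3) unfolding unitary_degrees_def by blast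
  have "adj (u * v) * (u * v) = adj v * (adj u * u) * v" "(u * v) * adj (u * v) = u * (v * adj v) * adj u"
    by (simp_all only: adj_mult mult.assoc)
  then have "adj (u * v) * (u * v) = 1" "(u * v) * adj (u * v) = 1"
    using uv by simp_all
  then show ?thesis
    unfolding unitary_degrees_def using uv cstar_subalgebraD(3)[OF B] homogeneous_mult by blast
qed

lemma unitary_degrees_minus:
  assumes B: "cstar_subalgebra B" and "n \<in> unitary_degrees B"
  shows "- n \<in> unitary_degrees B"
proof -
  obtain u where "u \<in> B" "homogeneous n u" "adj u * u = 1" "u * adj u = 1"
    using assms(2) unfolding unitary_degrees_def by blast
  then show ?thesis
    unfolding unitary_degrees_def
    using cstar_subalgebraD(5)[OF B] homogeneous_adj by (auto simp: adj_adj intro!: bexI[of _ "adj u"])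
qed

lemma unitary_degrees_zero: "1 \<in> B \<Longrightarrow> 0 \<in> unitary_degrees B"
  unfolding unitary_degrees_def using homogeneous_one by (auto intro!: bexI[of _ 1])

lemma unitary_degrees_combination:
  assumes B: "cstar_subalgebra B" "1 \<in> B" and g: "\<And>p. p \<in> P \<Longrightarrow> g p \<in> unitary_degrees B"
  shows "(\<Sum>p\<in>P. a p *s g p) \<in> unitary_degrees B"
proof -
  have nat: "of_nat k *s n \<in> unitary_degrees B" if "n \<in> unitary_degrees B" for k :: nat and n
  proof (induction k)
    case 0
    have "of_nat 0 *s n = 0"
      by (simp add: vec_eq_iff)
    then show ?case
      using unitary_degrees_zero[OF B(2)] by simp
  next
    case (Suc k)
    have "of_nat (Suc k) *s n = n + of_nat k *s n"
      by (simp add: vec_eq_iff distrib_right)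
    then show ?case
      using unitary_degrees_add[OF B(1) that Suc] by simp
  qed
  have int: "b *s n \<in> unitary_degrees B" if n: "n \<in> unitary_degrees B" for b n
  proof (cases b)
    case (nonneg k)
    then show ?thesis
      using nat[OF n, of k] by simp
  next
    case (neg k)
    then have "b *s n = - (of_nat (Suc k) *s n)"
      by (simp only: vec_eq_iff) simp
    then show ?thesis
      using unitary_degrees_minus[OF B(1) nat[OF n, of "Suc k"]] by simp
  qed
  show ?thesis
    using g
  proof (induction P rule: infinite_finite_induct)
    case (insert p P)
    then show ?case
      using unitary_degrees_add[OF B(1) int] by simp
  qed (simp_all add: unitary_degrees_zero B)
qed

lemma partial_isometry_sum:
  fixes a b :: "'i \<Rightarrow> 'a"
  assumes "finite I" "\<And>i k. i \<in> I \<Longrightarrow> k \<in> I \<Longrightarrow> adj (b i) * b k = (if i = k then 1 else 0)"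
  shows "(\<Sum>i\<in>I. a i * adj (b i)) * adj (\<Sum>i\<in>I. a i * adj (b i)) = (\<Sum>i\<in>I. a i * adj (a i))"
proof -
  have "(\<Sum>i\<in>I. a i * adj (b i)) * adj (\<Sum>i\<in>I. a i * adj (b i))
      = (\<Sum>i\<in>I. \<Sum>k\<in>I. a i * (adj (b i) * b k) * adj (a k))"
    by (simp add: adj_sum sum_product adj_mult adj_adj mult.assoc)
  also have "\<dots> = (\<Sum>i\<in>I. \<Sum>k\<in>I. if i = k then a i * adj (a k) else 0)"
    using assms(2) by (intro sum.cong refl) auto
  also have "\<dots> = (\<Sum>i\<in>I. a i * adj (a i))"
    using assms(1) by simp
  finally show ?thesis .
qed

text \<open>
  The sum is a partial isometry with range \<open>\<Sum> s\<^sub>u s\<^sub>u\<^sup>*\<close> over the words \<open>u\<close> of degree \<open>p\<close> and with source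
  the same sum over degree \<open>q\<close>; both are \<open>1\<close>.
\<close>

lemma bijection_unitary:
  assumes j: "bij_betw j (level d p) (level d q)"
  defines "V \<equiv> \<Sum>u\<in>level d p. sw d s u * adj (sw d s (j u))"
  shows "homogeneous (deg_int p - deg_int q) V" "V * adj V = 1" "adj V * V = 1"
proof -
  have ju: "j u \<in> level d q" if "u \<in> level d p" for u
    using bij_betwE[OF j] that by blast
  have "homogeneous (deg_int p + - deg_int q) (sw d s u * adj (sw d s (j u)))" if "u \<in> level d p" for u
  proof -
    have "d u = p" "d (j u) = q"
      using that ju[OF that] by (simp_all add: level_def)
    then show ?thesis
      using homogeneous_mult[OF homogeneous_sw[of u] homogeneous_adj[OF homogeneous_sw[of "j u"]]] by simp
  qed
  then show "homogeneous (deg_int p - deg_int q) V"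
    unfolding V_def by (simp add: homogeneous_sum)
  have inj: "j u = j v \<longleftrightarrow> u = v" if "u \<in> level d p" "v \<in> level d p" for u v
    using j that by (auto simp: bij_betw_def inj_on_def)
  have "V * adj V = (\<Sum>u\<in>level d p. sw d s u * adj (sw d s u))"
    unfolding V_def by (intro partial_isometry_sum finite_level) (simp add: sw_isometry[OF ju ju] inj)
  then show "V * adj V = 1"
    by (simp add: sw_sum)
  have adj_V: "adj V = (\<Sum>u\<in>level d p. sw d s (j u) * adj (sw d s u))"
    by (simp add: V_def adj_sum adj_mult adj_adj)
  have "adj V * adj (adj V) = (\<Sum>u\<in>level d p. sw d s (j u) * adj (sw d s (j u)))"
    unfolding adj_V by (intro partial_isometry_sum finite_level) (simp add: sw_isometry)
  also have "\<dots> = (\<Sum>v\<in>level d q. sw d s v * adj (sw d s v))"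
    by (rule sum.reindex_bij_betw[OF j])
  finally show "adj V * V = 1"
    by (simp add: sw_sum adj_adj)
qed

text \<open>
  Multiplying \<open>X\<close> of degree \<open>n\<close> by the adjoint of a unitary of degree \<open>n\<close> moves it into the core.
\<close>

lemma Cstar_intrinsic_degrees_eq:
  assumes S: "S \<subseteq> {X. \<exists>n\<in>intrinsic_group d. homogeneous n X}"
    and G: "intrinsic_group d \<subseteq> unitary_degrees (Cstar (core d s \<union> S))"
  shows "Cstar {X. \<exists>n\<in>intrinsic_group d. homogeneous n X} = Cstar (core d s \<union> S)"
proof
  let ?B = "Cstar (core d s \<union> S)"
  have "0 \<in> intrinsic_group d"
    by (simp add: intrinsic_group_def mpow_def)
  then have "core d s \<union> S \<subseteq> {X. \<exists>n\<in>intrinsic_group d. homogeneous n X}"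
    using S by (auto simp: core_eq)
  then show "?B \<subseteq> Cstar {X. \<exists>n\<in>intrinsic_group d. homogeneous n X}"
    by (intro Cstar_least cstar_subalgebra_Cstar order_trans[OF _ Cstar_superset])
  have "X \<in> ?B" if n: "n \<in> intrinsic_group d" and X: "homogeneous n X" for n X
  proof -
    obtain u where u: "u \<in> ?B" "homogeneous n u" "adj u * u = 1"
      using subsetD[OF G n] unfolding unitary_degrees_def by blast
    have "homogeneous 0 (X * adj u)"
      using homogeneous_mult[OF X homogeneous_adj[OF u(2)]] by simp
    then have "X * adj u \<in> ?B"
      using Cstar_superset[of "core d s \<union> S"] by (auto simp: core_eq)
    then have "X * adj u * u \<in> ?B"
      using u(1) by (rule cstar_subalgebraD(3)[OF cstar_subalgebra_Cstar])
    then show ?thesis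
      using u(3) by (simp add: mult.assoc)
  qed
  then show "Cstar {X. \<exists>n\<in>intrinsic_group d. homogeneous n X} \<subseteq> ?B"
    by (intro Cstar_least cstar_subalgebra_Cstar) auto
qed

end

section \<open>Generators of the fixed point algebra\<close>

theorem proposition3p4:
  fixes d :: "'l::monoid_mult \<Rightarrow> nat ^ 'k::{finite,linorder}"
    and s :: "'l \<Rightarrow> 'a::cstar_algebra"
    and r :: nat
    and g :: "nat \<Rightarrow> int ^ 'k::{finite,linorder}"
    and j :: "nat \<Rightarrow> 'l \<Rightarrow> 'l"
    and U :: "nat \<Rightarrow> 'a"
  assumes "single_vertex_kgraph d"
    and "is_O_theta d s"
    and aperiodic: "simple_cstar TYPE('a)"
    and "Z_basis r g (intrinsic_group d)"
    and "\<And>p. p \<in> {1..r} \<Longrightarrow> bij_betw (j p) (level d (pos_part (g p))) (level d (neg_part (g p)))"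
    and "\<And>p. p \<in> {1..r} \<Longrightarrow> U p = (\<Sum>u\<in>level d (pos_part (g p)). sw d s u * adj (sw d s (j p u)))"
    and "r = 0 \<Longrightarrow> U 0 = 1"
  shows "sigma_fixed d s = Cstar {X. \<exists>n\<in>intrinsic_group d. has_degree d s X n} \<and>
         Cstar {X. \<exists>n\<in>intrinsic_group d. has_degree d s X n} =
           Cstar (core d s \<union> U ` (if r = 0 then {0} else {1..r}))"
proof -
  interpret cuntz_algebra d s
    by (intro cuntz_algebra.intro cuntz_algebra_axioms.intro assms(1,2))
  let ?S = "U ` (if r = 0 then {0} else {1..r})"
  let ?B = "Cstar (core d s \<union> ?S)"
  note B = cstar_subalgebra_Cstar[of "core d s \<union> ?S"]
  have basis: "intrinsic_group d = {\<Sum>p\<in>{1..r}. a p *s g p | a. True}"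
    using assms(4) by (simp add: Z_basis_def)
  have g_in: "g p \<in> intrinsic_group d" if "p \<in> {1..r}" for p
  proof -
    have "(\<Sum>q\<in>{1..r}. (if q = p then 1 else 0) *s g q) = (\<Sum>q\<in>{1..r}. if q = p then g q else 0)"
      by (intro sum.cong refl) (simp add: vec_eq_iff)
    also have "\<dots> = g p"
      using that by simp
    finally show ?thesis
      unfolding basis by (intro CollectI exI[of _ "\<lambda>q. if q = p then 1 else 0"]) simp
  qed
  have U: "homogeneous (g p) (U p)" "U p * adj (U p) = 1" "adj (U p) * U p = 1" if "p \<in> {1..r}" for p
    using bijection_unitary[OF assms(5)[OF that]]
    unfolding assms(6)[OF that, symmetric] pos_part_minus_neg_part by auto
  have one: "1 \<in> core d s"
    using homogeneous_one by (simp add: core_eq)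
  have "?S \<subseteq> {X. \<exists>n\<in>intrinsic_group d. homogeneous n X}"
  proof (cases "r = 0")
    case True
    have "0 \<in> intrinsic_group d"
      by (simp add: intrinsic_group_def mpow_def)
    then show ?thesis
      using True assms(7) homogeneous_one by auto
  next
    case False
    show ?thesis
    proof
      fix X assume "X \<in> ?S"
      then obtain p where "p \<in> {1..r}" "X = U p"
        using False by auto
      then show "X \<in> {X. \<exists>n\<in>intrinsic_group d. homogeneous n X}"
        using U(1) g_in by blast
    qed
  qed
  moreover have "intrinsic_group d \<subseteq> unitary_degrees ?B"
  proof -
    have "g p \<in> unitary_degrees ?B" if "p \<in> {1..r}" for p
    proof -
      have "U p \<in> ?B"
        using that by (intro subsetD[OF Cstar_superset]) auto
      then show ?thesis
        unfolding unitary_degrees_def using U[OF that] by blast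
    qed
    moreover have "1 \<in> ?B"
      using one by (intro subsetD[OF Cstar_superset]) auto
    ultimately show ?thesis
      unfolding basis using unitary_degrees_combination[OF B] by blast
  qed
  ultimately show ?thesis
    unfolding has_degree_iff_homogeneous
    using sigma_fixed_eq Cstar_intrinsic_degrees_eq[of ?S] by simp
qed

end
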